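(* Let $(G_n)_{n\in\omega}$ be a tower of topological groups, $G=\bigcup_{n\in\omega}G_n$, and let $G_n^{\mathrm L}$ denote $G_n$ endowed with its left uniformity. Then: (1) the topology of the uniform direct limit $\mathrm{u}\text{-}\varinjlim G_n^{\mathrm L}$ coincides with the topology $\overrightarrow{\tau}$ on the group $G$; (2) for any adequate family $\mathcal A\subset\bigwedge_{n\in\omega}\mathcal{PM}_{G_n^{\mathrm L}}$, the uniformity of $\mathrm{u}\text{-}\varinjlim G_n^{\mathrm L}$ is generated by the family of pseudometrics $\{\varinjlim d_n:(d_n)_{n\in\omega}\in\mathcal A\}$.
   Context: $\omega=\{0,1,2,\dots\}$. Topological groups and uniform spaces are not assumed Hausdorff/separated. A tower of topological groups is a sequence $G_0\subset G_1\subset G_2\subset\cdots$ of topological groups in which each $G_n$ is a topological subgroup of $G_{n+1}$ (a subgroup carrying the subspace topology); $G=\bigcup_{n\in\omega}G_n$ is its union, with neutral element $e$. Topology $\overrightarrow{\tau}$: for each $n$ fix a neighborhood base $\mathcal B_n$ at $e$ in $G_n$ consisting of open symmetric neighborhoods $U=U^{-1}\subset G_n$. For $(U_n)_{n\in\omega}$ put $\overrightarrow{\prod}_{n\in\omega}U_n=\bigcup_{m\in\omega}U_0U_1\cdots U_m$. The topology $\overrightarrow{\tau}$ on $G$ is generated by the base of sets $\big(\overrightarrow{\prod}_{n\in\omega}U_n\big)\cdot x$, $x\in G$, $(U_n)_{n\in\omega}\in\prod_{n\in\omega}\mathcal B_n$. With it $G$ is a semitopological group (translations are continuous), having the sets $\overrightarrow{\prod}_{n\in\omega}U_n$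 as a neighborhood base at $e$. Left uniformity: on a topological group $K$ it is generated by the entourages $\{(x,y)\in K\times K: x\in yU\}$, $U$ an open symmetric neighborhood of the neutral element. The uniform spaces $G_n^{\mathrm L}$ form a tower of uniform spaces (each is a uniform subspace of the next). Uniform direct limit: for an increasing sequence of uniform spaces $X_0\subset X_1\subset\cdots$ with uniformly continuous inclusions, $\mathrm{u}\text{-}\varinjlim X_n$ is the union $X=\bigcup_n X_n$ endowed with the strongest (not necessarily separated) uniformity making all inclusions $X_n\to X$ uniformly continuous. Pseudometrics: a pseudometric $d$ on a uniform space $Y$ is uniform if for every $\varepsilon>0$ the set $\{d<\varepsilon\}:=\{(x,y)\in Y\times Y: d(x,y)<\varepsilon\}$ belongs to the uniformity $\mathcal U_Y$ of $Y$; $\mathcal{PM}_Y$ is the family of all uniform pseudometrics on $Y$. A uniformity is generated by a family $\mathcal D$ of pseudometrics if the sets $\{d<1\}$, $d\in\mathcal D$, form a base of the uniformity. For a tower $(X_n)$ of uniform spaces, $\bigwedge_{n\in\omega}\mathcal{PM}_{X_n}$ is the set of all monotone sequences $(d_n)_{n\in\omega}\in\prod_{n}\mathcal{PM}_{X_n}$, i.e. those with $d_n\le d_{n+1}|_{X_n\times X_n}$ for all $n$. A family $\mathcal A\subset\bigwedge_{n}\mathcal{PM}_{X_n}$ is adequate if for each $(U_n)_{n\in\omega}\in\prod_{n}\mathcal U_{X_n}$ there is $(d_n)_{n\in\omega}\in\mathcal A$ with $\{d_n<1\}\subset U_n$ for all $n$. Limit operator: for $x\in X=\bigcup_nX_n$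 let $|x|=\min\{n\in\omega:x\in X_n\}$, and $|x,y|=\max\{|x|,|y|\}$. For $(d_n)\in\prod_n\mathcal{PM}_{X_n}$ the pseudometric $\varinjlim d_n$ on $X$ is $$(\varinjlim d_n)(x,y)=\inf\Big\{\sum_{i=1}^m d_{|x_{i-1},x_i|}(x_{i-1},x_i):\ m\ge 1,\ x_0,\dots,x_m\in X,\ x=x_0,\ x_m=y\Big\}.$$ *)

theory Defs
  imports "HOL-Analysis.Analysis" "HOL-Algebra.Coset"
begin

section \<open>Uniform spaces with explicit carrier\<close>

text \<open>
  The type class of uniform spaces fixes one uniformity per type.  Here several uniformities on
  varying subsets of one type are compared, so a uniformity on a set \<open>X\<close> is the set of its
  entourages.  No separation axiom is imposed.
\<close>

definition uniformity_on :: "'a set \<Rightarrow> ('a \<times> 'a) set set \<Rightarrow> bool" where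
  "uniformity_on X \<U> \<longleftrightarrow>
     X \<times> X \<in> \<U> \<and>
     (\<forall>E\<in>\<U>. E \<subseteq> X \<times> X \<and> Id_on X \<subseteq> E) \<and>
     (\<forall>E\<in>\<U>. \<forall>F. E \<subseteq> F \<and> F \<subseteq> X \<times> X \<longrightarrow> F \<in> \<U>) \<and>
     (\<forall>E\<in>\<U>. \<forall>F\<in>\<U>. E \<inter> F \<in> \<U>) \<and>
     (\<forall>E\<in>\<U>. E\<inverse> \<in> \<U>) \<and>
     (\<forall>E\<in>\<U>. \<exists>F\<in>\<U>. F O F \<subseteq> E)"

lemma uniformity_onD:
  assumes "uniformity_on X \<U>"
  shows "X \<times> X \<in> \<U>"
    and "E \<in> \<U> \<Longrightarrow> E \<subseteq> X \<times> X"
    and "E \<in> \<U> \<Longrightarrow> Id_on X \<subseteq> E"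
    and "E \<in> \<U> \<Longrightarrow> E \<subseteq> F \<Longrightarrow> F \<subseteq> X \<times> X \<Longrightarrow> F \<in> \<U>"
    and "E \<in> \<U> \<Longrightarrow> F \<in> \<U> \<Longrightarrow> E \<inter> F \<in> \<U>"
    and "E \<in> \<U> \<Longrightarrow> E\<inverse> \<in> \<U>"
    and "E \<in> \<U> \<Longrightarrow> \<exists>F\<in>\<U>. F O F \<subseteq> E"
  using assms unfolding uniformity_on_def by (elim conjE; meson)+

definition uniformity_base :: "('a \<times> 'a) set set \<Rightarrow> ('a \<times> 'a) set set \<Rightarrow> bool" where
  "uniformity_base \<U> \<B> \<longleftrightarrow> \<B> \<subseteq> \<U> \<and> (\<forall>E\<in>\<U>. \<exists>B\<in>\<B>. B \<subseteq> E)"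

definition uniform_topology :: "'a set \<Rightarrow> ('a \<times> 'a) set set \<Rightarrow> 'a topology" where
  "uniform_topology X \<U> = topology (\<lambda>S. S \<subseteq> X \<and> (\<forall>x\<in>S. \<exists>E\<in>\<U>. E `` {x} \<subseteq> S))"

lemma openin_uniform_topology:
  assumes "uniformity_on X \<U>"
  shows "openin (uniform_topology X \<U>) S \<longleftrightarrow> S \<subseteq> X \<and> (\<forall>x\<in>S. \<exists>E\<in>\<U>. E `` {x} \<subseteq> S)"
proof -
  have "istopology (\<lambda>S. S \<subseteq> X \<and> (\<forall>x\<in>S. \<exists>E\<in>\<U>. E `` {x} \<subseteq> S))"
    unfolding istopology_def
  proof (intro conjI allI impI, goal_cases)
    case (2 S T)
    show ?case
    proof
      fix x assume "x \<in> S \<inter> T"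
      with 2 obtain E F where "E \<in> \<U>" "F \<in> \<U>" "E `` {x} \<subseteq> S" "F `` {x} \<subseteq> T" by blast
      moreover from this have "E \<inter> F \<in> \<U>" using uniformity_onD(5)[OF assms] by simp
      ultimately show "\<exists>E\<in>\<U>. E `` {x} \<subseteq> S \<inter> T" by blast
    qed
  next
    case (4 \<K>)
    then show ?case by (meson UnionE Union_upper order_trans)
  qed blast+
  then show ?thesis
    unfolding uniform_topology_def by (simp add: topology_inverse')
qed

definition uniformly_continuous_map ::
  "'a set \<Rightarrow> ('a \<times> 'a) set set \<Rightarrow> 'b set \<Rightarrow> ('b \<times> 'b) set set \<Rightarrow> ('a \<Rightarrow> 'b) \<Rightarrow> bool" where
  "uniformly_continuous_map X \<U> Y \<V> f \<longleftrightarrow>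
     f \<in> X \<rightarrow> Y \<and> (\<forall>V\<in>\<V>. {(x, y) \<in> X \<times> X. (f x, f y) \<in> V} \<in> \<U>)"

text \<open>A stronger uniformity has more entourages, so the strongest one is the greatest
  with respect to inclusion.\<close>

definition uniform_direct_limit ::
  "(nat \<Rightarrow> 'a set) \<Rightarrow> (nat \<Rightarrow> ('a \<times> 'a) set set) \<Rightarrow> ('a \<times> 'a) set set" where
  "uniform_direct_limit X \<U> =
     (GREATEST \<W>. uniformity_on (\<Union>n. X n) \<W> \<and>
        (\<forall>n. uniformly_continuous_map (X n) (\<U> n) (\<Union>n. X n) \<W> (\<lambda>x. x)))"

lemma uniform_direct_limit_greatest:
  fixes X :: "nat \<Rightarrow> 'a set" and \<U> :: "nat \<Rightarrow> ('a \<times> 'a) set set"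
  defines "P \<equiv> \<lambda>\<W>. uniformity_on (\<Union>n. X n) \<W> \<and>
             (\<forall>n. uniformly_continuous_map (X n) (\<U> n) (\<Union>n. X n) \<W> (\<lambda>x. x))"
  assumes unif: "\<And>n. uniformity_on (X n) (\<U> n)"
  shows "P (uniform_direct_limit X \<U>)" and "P \<W> \<Longrightarrow> \<W> \<subseteq> uniform_direct_limit X \<U>"
proof -
  define Y where "Y = (\<Union>n. X n)"
  define \<S> where "\<S> = {\<W>. P \<W>}"
  define M where "M = {E. E \<subseteq> Y \<times> Y \<and> (\<exists>F. finite F \<and> F \<subseteq> \<Union>\<S> \<and> Y \<times> Y \<inter> \<Inter>F \<subseteq> E)}"
  have MI: "E \<in> M" if "E \<subseteq> Y \<times> Y" "finite F" "F \<subseteq> \<Union>\<S>" "Y \<times> Y \<inter> \<Inter>F \<subseteq> E" for E F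
    unfolding M_def using that by (intro CollectI conjI exI[of _ F])
  have U: "\<W> \<in> \<S> \<Longrightarrow> uniformity_on Y \<W>" for \<W>
    unfolding \<S>_def P_def Y_def by simp
  have C: "{(x, y) \<in> X n \<times> X n. (x, y) \<in> E} \<in> \<U> n" if "E \<in> \<Union>\<S>" for E n
    using that unfolding \<S>_def P_def uniformly_continuous_map_def by blast
  have "uniformity_on Y M"
    unfolding uniformity_on_def
  proof (intro conjI ballI allI impI)
    show "Y \<times> Y \<in> M" unfolding M_def by auto
  next
    fix E assume "E \<in> M" then show "E \<subseteq> Y \<times> Y" unfolding M_def by auto
  next
    fix E assume "E \<in> M"
    then obtain F where F: "F \<subseteq> \<Union>\<S>" "Y \<times> Y \<inter> \<Inter>F \<subseteq> E" unfolding M_def by auto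
    have "Id_on Y \<subseteq> A" if mem: "A \<in> F" for A
    proof -
      obtain \<W> where "\<W> \<in> \<S>" "A \<in> \<W>" using mem F(1) by blast
      then show ?thesis using uniformity_onD(3)[OF U] by simp
    qed
    then show "Id_on Y \<subseteq> E" using F(2) by blast
  next
    fix E F assume "E \<in> M" and F: "E \<subseteq> F \<and> F \<subseteq> Y \<times> Y"
    then obtain A where *: "finite A" "A \<subseteq> \<Union>\<S>" "Y \<times> Y \<inter> \<Inter>A \<subseteq> E"
      unfolding M_def by auto
    show "F \<in> M"
      by (rule MI[OF conjunct2[OF F] *(1,2) order_trans[OF *(3) conjunct1[OF F]]])
  next
    fix E F assume "E \<in> M" "F \<in> M"
    then obtain A B where *: "finite A" "A \<subseteq> \<Union>\<S>" "Y \<times> Y \<inter> \<Inter>A \<subseteq> E"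
      "finite B" "B \<subseteq> \<Union>\<S>" "Y \<times> Y \<inter> \<Inter>B \<subseteq> F" "E \<subseteq> Y \<times> Y" unfolding M_def by auto
    have "E \<inter> F \<subseteq> Y \<times> Y" using *(7) by (rule le_infI1)
    moreover have "Y \<times> Y \<inter> \<Inter>(A \<union> B) \<subseteq> E \<inter> F"
      unfolding Inter_Un_distrib using *(3,6) by (meson Int_greatest Int_lower1 Int_lower2 Int_mono order_refl order_trans)
    ultimately show "E \<inter> F \<in> M" using *(1,2,4,5) by (intro MI[of _ "A \<union> B"]) simp_all
  next
    fix E assume "E \<in> M"
    then obtain A where *: "E \<subseteq> Y \<times> Y" "finite A" "A \<subseteq> \<Union>\<S>" "Y \<times> Y \<inter> \<Inter>A \<subseteq> E"
      unfolding M_def by auto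
    have "B\<inverse> \<in> \<Union>\<S>" if mem: "B \<in> A" for B
    proof -
      obtain \<W> where "\<W> \<in> \<S>" "B \<in> \<W>" using mem *(3) by blast
      then show ?thesis using uniformity_onD(6)[OF U, of \<W> B] by blast
    qed
    then have "converse ` A \<subseteq> \<Union>\<S>" by blast
    moreover have "Y \<times> Y \<inter> \<Inter>(converse ` A) \<subseteq> E\<inverse>" using *(4) by auto
    moreover have "E\<inverse> \<subseteq> Y \<times> Y" using *(1) by auto
    ultimately show "E\<inverse> \<in> M" using *(2)
      by (intro MI[of _ "converse ` A"]) simp_all
  next
    fix E assume "E \<in> M"
    then obtain A where *: "E \<subseteq> Y \<times> Y" "finite A" "A \<subseteq> \<Union>\<S>" "Y \<times> Y \<inter> \<Inter>A \<subseteq> E"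
      unfolding M_def by auto
    have "\<exists>K \<in> \<Union>\<S>. K O K \<subseteq> B" if mem: "B \<in> A" for B
    proof -
      obtain \<W> where "\<W> \<in> \<S>" "B \<in> \<W>" using mem *(3) by blast
      then show ?thesis using uniformity_onD(7)[OF U, of \<W> B] by blast
    qed
    then obtain h where h: "\<And>B. B \<in> A \<Longrightarrow> h B \<in> \<Union>\<S> \<and> h B O h B \<subseteq> B" by metis
    let ?F = "Y \<times> Y \<inter> \<Inter>(h ` A)"
    have "h ` A \<subseteq> \<Union>\<S>" using h by (simp add: image_subset_iff)
    then have "?F \<in> M" using *(2) by (intro MI[of _ "h ` A"]) (simp_all only: finite_imageI Int_lower1 order_refl)
    moreover have "?F O ?F \<subseteq> E"
    proof
      fix z assume "z \<in> ?F O ?F"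
      then obtain a b c where z: "z = (a, c)" "(a, b) \<in> ?F" "(b, c) \<in> ?F" by auto
      then have "(a, c) \<in> B" if "B \<in> A" for B using h[OF that] that by blast
      then show "z \<in> E" using z *(4) by blast
    qed
    ultimately show "\<exists>F\<in>M. F O F \<subseteq> E" by blast
  qed
  moreover have "uniformly_continuous_map (X n) (\<U> n) Y M (\<lambda>x. x)" for n
    unfolding uniformly_continuous_map_def
  proof (intro conjI ballI)
    show "(\<lambda>x. x) \<in> X n \<rightarrow> Y" unfolding Y_def by auto
  next
    fix E assume "E \<in> M"
    then obtain A where *: "finite A" "A \<subseteq> \<Union>\<S>" "Y \<times> Y \<inter> \<Inter>A \<subseteq> E"
      unfolding M_def by auto
    have "X n \<times> X n \<inter> \<Inter>A \<in> \<U> n" using *(1,2)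
    proof (induction rule: finite_induct)
      case empty
      then show ?case using uniformity_onD(1)[OF unif] by simp
    next
      case (insert B A)
      have "{(x, y) \<in> X n \<times> X n. (x, y) \<in> B} \<inter> (X n \<times> X n \<inter> \<Inter>A) \<in> \<U> n"
      proof (rule uniformity_onD(5)[OF unif])
        show "{(x, y) \<in> X n \<times> X n. (x, y) \<in> B} \<in> \<U> n" using insert.prems by (intro C) auto
        show "X n \<times> X n \<inter> \<Inter>A \<in> \<U> n" using insert.prems by (intro insert.IH) auto
      qed
      moreover have "{(x, y) \<in> X n \<times> X n. (x, y) \<in> B} \<inter> (X n \<times> X n \<inter> \<Inter>A)
          = X n \<times> X n \<inter> \<Inter>(insert B A)" by auto
      ultimately show ?case by simp
    qed
    moreover have "X n \<times> X n \<inter> \<Inter>A \<subseteq> {(x, y) \<in> X n \<times> X n. (x, y) \<in> E}"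
      using *(3) unfolding Y_def by blast
    moreover have "{(x, y) \<in> X n \<times> X n. (x, y) \<in> E} \<subseteq> X n \<times> X n" by auto
    ultimately show "{(x, y) \<in> X n \<times> X n. (x, y) \<in> E} \<in> \<U> n"
      by (rule uniformity_onD(4)[OF unif])
  qed
  ultimately have PM: "P M" unfolding P_def Y_def by simp
  have le: "\<W> \<subseteq> M" if "P \<W>" for \<W>
  proof
    fix E assume E: "E \<in> \<W>"
    then have "E \<subseteq> Y \<times> Y" using that uniformity_onD(2) unfolding P_def Y_def by blast
    moreover have "{E} \<subseteq> \<Union>\<S>" using that E unfolding \<S>_def by blast
    ultimately show "E \<in> M" by (intro MI[of _ "{E}"]) simp_all
  qed
  have "uniform_direct_limit X \<U> = M"
    unfolding uniform_direct_limit_def P_def[symmetric]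
    by (rule Greatest_equality) (use PM le in \<open>auto simp: P_def\<close>)
  then show "P (uniform_direct_limit X \<U>)" "P \<W> \<Longrightarrow> \<W> \<subseteq> uniform_direct_limit X \<U>"
    using PM le by auto
qed

section \<open>Uniform pseudometrics\<close>

text \<open>A pseudometric on \<open>X\<close> is a total function; its values off \<open>X\<close> are irrelevant to every
  definition below.\<close>

definition pseudometric_on :: "'a set \<Rightarrow> ('a \<Rightarrow> 'a \<Rightarrow> real) \<Rightarrow> bool" where
  "pseudometric_on X d \<longleftrightarrow>
     (\<forall>x\<in>X. \<forall>y\<in>X. 0 \<le> d x y \<and> d x y = d y x) \<and>
     (\<forall>x\<in>X. d x x = 0) \<and>
     (\<forall>x\<in>X. \<forall>y\<in>X. \<forall>z\<in>X. d x z \<le> d x y + d y z)"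

definition pseudometric_entourage :: "'a set \<Rightarrow> ('a \<Rightarrow> 'a \<Rightarrow> real) \<Rightarrow> real \<Rightarrow> ('a \<times> 'a) set" where
  "pseudometric_entourage X d \<epsilon> = {(x, y) \<in> X \<times> X. d x y < \<epsilon>}"

definition uniform_pseudometrics ::
  "'a set \<Rightarrow> ('a \<times> 'a) set set \<Rightarrow> ('a \<Rightarrow> 'a \<Rightarrow> real) set" where
  "uniform_pseudometrics X \<U> =
     {d. pseudometric_on X d \<and> (\<forall>\<epsilon>>0. pseudometric_entourage X d \<epsilon> \<in> \<U>)}"

definition uniformity_generated_by_pseudometrics ::
  "'a set \<Rightarrow> ('a \<times> 'a) set set \<Rightarrow> ('a \<Rightarrow> 'a \<Rightarrow> real) set \<Rightarrow> bool" where
  "uniformity_generated_by_pseudometrics X \<U> \<D> \<longleftrightarrow>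
     (\<forall>d\<in>\<D>. pseudometric_on X d) \<and>
     uniformity_base \<U> ((\<lambda>d. pseudometric_entourage X d 1) ` \<D>)"

definition monotone_pseudometrics ::
  "(nat \<Rightarrow> 'a set) \<Rightarrow> (nat \<Rightarrow> ('a \<times> 'a) set set) \<Rightarrow> (nat \<Rightarrow> 'a \<Rightarrow> 'a \<Rightarrow> real) set" where
  "monotone_pseudometrics X \<U> =
     {d. (\<forall>n. d n \<in> uniform_pseudometrics (X n) (\<U> n)) \<and>
         (\<forall>n. \<forall>x\<in>X n. \<forall>y\<in>X n. d n x y \<le> d (Suc n) x y)}"

definition adequate_family ::
  "(nat \<Rightarrow> 'a set) \<Rightarrow> (nat \<Rightarrow> ('a \<times> 'a) set set) \<Rightarrow> (nat \<Rightarrow> 'a \<Rightarrow> 'a \<Rightarrow> real) set \<Rightarrow> bool" where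
  "adequate_family X \<U> \<A> \<longleftrightarrow>
     \<A> \<subseteq> monotone_pseudometrics X \<U> \<and>
     (\<forall>E. (\<forall>n. E n \<in> \<U> n) \<longrightarrow>
        (\<exists>d\<in>\<A>. \<forall>n. pseudometric_entourage (X n) (d n) 1 \<subseteq> E n))"

text \<open>Least stage containing \<open>x\<close>; meaningful only for \<open>x \<in> (\<Union>n. X n)\<close>.\<close>

definition level :: "(nat \<Rightarrow> 'a set) \<Rightarrow> 'a \<Rightarrow> nat" where
  "level X x = (LEAST n. x \<in> X n)"

definition level2 :: "(nat \<Rightarrow> 'a set) \<Rightarrow> 'a \<Rightarrow> 'a \<Rightarrow> nat" where
  "level2 X x y = max (level X x) (level X y)"

definition lim_pseudometric ::
  "(nat \<Rightarrow> 'a set) \<Rightarrow> (nat \<Rightarrow> 'a \<Rightarrow> 'a \<Rightarrow> real) \<Rightarrow> 'a \<Rightarrow> 'a \<Rightarrow> real" where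
  "lim_pseudometric X d x y =
     Inf {(\<Sum>i=1..m. d (level2 X (z (i - 1)) (z i)) (z (i - 1)) (z i)) | (m::nat) z.
            m \<ge> 1 \<and> (\<forall>i\<le>m. z i \<in> (\<Union>n. X n)) \<and> z 0 = x \<and> z m = y}"

section \<open>Towers of topological groups\<close>

definition topological_group :: "('a, 'b) monoid_scheme \<Rightarrow> 'a topology \<Rightarrow> bool" where
  "topological_group G T \<longleftrightarrow>
     group G \<and> topspace T = carrier G \<and>
     continuous_map (prod_topology T T) T (\<lambda>(x, y). x \<otimes>\<^bsub>G\<^esub> y) \<and>
     continuous_map T T (\<lambda>x. inv\<^bsub>G\<^esub> x)"

definition tower_of_topological_groups ::
  "(nat \<Rightarrow> 'a monoid) \<Rightarrow> (nat \<Rightarrow> 'a topology) \<Rightarrow> bool" where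
  "tower_of_topological_groups G T \<longleftrightarrow>
     (\<forall>n. topological_group (G n) (T n) \<and>
          carrier (G n) \<subseteq> carrier (G (Suc n)) \<and>
          (\<forall>x\<in>carrier (G n). \<forall>y\<in>carrier (G n). x \<otimes>\<^bsub>G n\<^esub> y = x \<otimes>\<^bsub>G (Suc n)\<^esub> y) \<and>
          T n = subtopology (T (Suc n)) (carrier (G n)))"

text \<open>The product of two elements is taken in the first group containing both of them.\<close>

definition union_group :: "(nat \<Rightarrow> 'a monoid) \<Rightarrow> 'a monoid" where
  "union_group G =
     \<lparr>carrier = (\<Union>n. carrier (G n)),
      mult = (\<lambda>x y. x \<otimes>\<^bsub>G (level2 (\<lambda>n. carrier (G n)) x y)\<^esub> y),
      one = \<one>\<^bsub>G 0\<^esub>\<rparr>"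

definition open_symmetric_nbhds :: "('a, 'b) monoid_scheme \<Rightarrow> 'a topology \<Rightarrow> 'a set set" where
  "open_symmetric_nbhds G T = {U. openin T U \<and> \<one>\<^bsub>G\<^esub> \<in> U \<and> set_inv\<^bsub>G\<^esub> U = U}"

definition symmetric_nbhd_base ::
  "('a, 'b) monoid_scheme \<Rightarrow> 'a topology \<Rightarrow> 'a set set \<Rightarrow> bool" where
  "symmetric_nbhd_base G T \<B> \<longleftrightarrow>
     \<B> \<subseteq> open_symmetric_nbhds G T \<and>
     (\<forall>V. openin T V \<and> \<one>\<^bsub>G\<^esub> \<in> V \<longrightarrow> (\<exists>U\<in>\<B>. U \<subseteq> V))"

definition left_uniformity ::
  "('a, 'b) monoid_scheme \<Rightarrow> 'a topology \<Rightarrow> ('a \<times> 'a) set set" where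
  "left_uniformity G T =
     {E. E \<subseteq> carrier G \<times> carrier G \<and>
         (\<exists>U\<in>open_symmetric_nbhds G T.
            {(x, y) \<in> carrier G \<times> carrier G. x \<in> y <#\<^bsub>G\<^esub> U} \<subseteq> E)}"

fun initial_product :: "('a, 'b) monoid_scheme \<Rightarrow> (nat \<Rightarrow> 'a set) \<Rightarrow> nat \<Rightarrow> 'a set" where
  "initial_product G U 0 = U 0"
| "initial_product G U (Suc m) = initial_product G U m <#>\<^bsub>G\<^esub> U (Suc m)"

definition directed_product :: "('a, 'b) monoid_scheme \<Rightarrow> (nat \<Rightarrow> 'a set) \<Rightarrow> 'a set" where
  "directed_product G U = (\<Union>m. initial_product G U m)"

text \<open>The generating sets form a base of a topology when \<open>G\<close> is a tower and every \<open>\<B> n\<close> is a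
  neighbourhood base at the neutral element, so generating by finite intersections and unions
  gives the topology with that base.\<close>

definition tau_right ::
  "(nat \<Rightarrow> 'a monoid) \<Rightarrow> (nat \<Rightarrow> 'a set set) \<Rightarrow> 'a topology" where
  "tau_right G \<B> =
     topology_generated_by
       {directed_product (union_group G) U #>\<^bsub>union_group G\<^esub> x | U x.
          (\<forall>n. U n \<in> \<B> n) \<and> x \<in> carrier (union_group G)}"

end

theory Submission
  imports Defs
begin

text \<open>
  For entourages \<open>E n\<close> of the stages, consider chains that descend through the stages and then ascend,
  with at most one step from each \<open>E n\<close> on either side. Choose \<open>F\<close> with \<open>(F n)\<^sup>5 \<subseteq> E n\<close> such that the
  trace of \<open>(F (n + 1))\<^sup>3\<close> on \<open>X n\<close> lies in \<open>F n\<close>. Then the peak formed by two consecutive \<open>F\<close>-chains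
  collapses stage by stage, so the relations given by such chains form a base of a uniformity, and by
  maximality this uniformity is the direct limit. Both statements follow: chains of small total cost can
  be shortened to descending-ascending ones because a lower stage measures the same step more cheaply,
  and in a tower of groups an ascending chain from \<open>y\<close> with steps in \<open>y\<inverse> U\<^sub>n y\<close> runs through the points
  of \<open>U\<^sub>0 U\<^sub>1 \<cdots> U\<^sub>m y\<close>.
\<close>

section \<open>Entourages\<close>

text \<open>The constants come from merging a peak. If both \<open>F\<close>-chains turn around at
  the top stage, five steps remain: two from each chain and the link between them. If both go
  further down, the link and its two neighbouring steps join points of the stage below, and the
  trace of the cube turns them into a link of that stage. The product sets in
  \<open>tau_right\<close> are reached by ascending chains, whereas a limit entourage also allows
  descent. Descent is harmless near a fixed point: once \<open>y\<close> lies in \<open>X k\<close>,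
  the steps from \<open>y\<close> down to another point of \<open>X k\<close> amount to one small
  step inside \<open>X k\<close>. An entourage has no fixed starting point, so there the chains stay
  two-sided. The base sets are right translates while the uniformity is the left one. The identity
  \<open>q u y = (q y) (y\<inverse> u y)\<close> reconciles them, since conjugation by a fixed
  \<open>y\<close> is continuous in every stage that contains \<open>y\<close>. The stages before
  \<open>y\<close> appears need separate care in both directions.\<close>

lemma relcomp3E:
  assumes "p \<in> A O B O C"
  obtains x a b y where "p = (x, y)" "(x, a) \<in> A" "(a, b) \<in> B" "(b, y) \<in> C"
proof -
  from assms obtain x a y where "p = (x, y)" "(x, a) \<in> A" "(a, y) \<in> B O C" by (rule relcompE)
  moreover from this(3) obtain b where "(a, b) \<in> B" "(b, y) \<in> C" by (rule relcompEpair)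
  ultimately show thesis using that by blast
qed

lemma uniformity_on_refl:
  assumes "uniformity_on X \<U>" "E \<in> \<U>" "x \<in> X"
  shows "(x, x) \<in> E"
  using uniformity_onD(3)[OF assms(1,2)] assms(3) by blast

text \<open>Three halvings leave room for eight steps; the missing ones are trivial steps at the end
  point \<open>d\<close>.\<close>

lemma uniformity_on_fivefold:
  assumes U: "uniformity_on X \<U>" and E: "E \<in> \<U>"
  obtains F where "F \<in> \<U>" "F O F O F O F O F \<subseteq> E"
proof -
  obtain A where A: "A \<in> \<U>" "A O A \<subseteq> E" using uniformity_onD(7)[OF U E] by blast
  obtain B where B: "B \<in> \<U>" "B O B \<subseteq> A" using uniformity_onD(7)[OF U A(1)] by blast
  obtain F where F: "F \<in> \<U>" "F O F \<subseteq> B" using uniformity_onD(7)[OF U B(1)] by blast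
  have "F O F O F O F O F \<subseteq> E"
  proof
    fix p assume "p \<in> F O F O F O F O F"
    then obtain a b c d where 1: "p = (a, d)" "(a, b) \<in> F" "(b, c) \<in> F" "(c, d) \<in> F O F O F"
      by (rule relcomp3E)
    from 1(4) obtain e f where 2: "(c, e) \<in> F" "(e, f) \<in> F" "(f, d) \<in> F"
      by (elim relcompEpair)
    have refl: "(d, d) \<in> H" if "H \<in> \<U>" for H
      using that 2(3) uniformity_onD(2)[OF U F(1)] uniformity_on_refl[OF U] by blast
    have "(a, c) \<in> B" "(c, f) \<in> B" "(f, d) \<in> B"
      using F 1 2 refl[OF F(1)] by blast+
    then have "(a, f) \<in> A" "(f, d) \<in> A" using B refl[OF B(1)] by blast+
    then show "p \<in> E" using A(2) 1(1) by blast
  qed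
  with F(1) that show thesis by blast
qed

lemma uniformity_on_cube_of_fivefold:
  assumes U: "uniformity_on X \<U>" and F: "F \<in> \<U>"
  shows "F O F O F \<subseteq> F O F O F O F O F"
proof
  fix p assume "p \<in> F O F O F"
  then obtain x a b y where p: "p = (x, y)" "(x, a) \<in> F" "(a, b) \<in> F" "(b, y) \<in> F"
    by (rule relcomp3E)
  then have "(y, y) \<in> F"
    using uniformity_onD(2)[OF U F] uniformity_on_refl[OF U F] by blast
  with p(2-4) show "p \<in> F O F O F O F O F" unfolding p(1) by (intro relcompI)
qed

text \<open>Such sequences replace geometrically shrinking radii: a finite chain of ever finer steps
  stays inside \<open>E\<close>, and the cube leaves room for finer steps on both sides of a middle
  one.\<close>

lemma uniformity_on_cube_sequence:
  assumes U: "uniformity_on X \<U>" and E: "E \<in> \<U>"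
  obtains F :: "nat \<Rightarrow> ('a \<times> 'a) set"
  where "\<And>k. F k \<in> \<U>" "F 0 = E" "\<And>k. F (Suc k) O F (Suc k) O F (Suc k) \<subseteq> F k"
proof -
  have step: "\<exists>B. B \<in> \<U> \<and> B O B O B \<subseteq> A" if A: "A \<in> \<U>" for A
  proof -
    obtain B where B: "B \<in> \<U>" "B O B O B O B O B \<subseteq> A"
      using uniformity_on_fivefold[OF U A] .
    have "B O B O B \<subseteq> A" using uniformity_on_cube_of_fivefold[OF U B(1)] B(2) by blast
    with B(1) show ?thesis by blast
  qed
  \<comment> \<open>The clause for \<open>k = 0\<close> pins the start of the sequence to
    \<open>E\<close>.\<close>
  have "\<exists>F. \<forall>k. (F k \<in> \<U> \<and> (k = 0 \<longrightarrow> F k = E)) \<and> F (Suc k) O F (Suc k) O F (Suc k) \<subseteq> F k"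
    by (rule dependent_nat_choice) (use E step in auto)
  with that show thesis by blast
qed

lemma uniformity_on_cube_square:
  assumes U: "uniformity_on X \<U>" and "F \<in> \<U>" "F O F O F \<subseteq> E"
  shows "F O F \<subseteq> E" "F \<subseteq> E"
proof -
  have refl: "(y, y) \<in> F" if "(x, y) \<in> F" for x y
    using that uniformity_on_refl[OF U assms(2)] uniformity_onD(2)[OF U assms(2)] by blast
  have E: "(x, y) \<in> E" if "(x, a) \<in> F" "(a, b) \<in> F" "(b, y) \<in> F" for x a b y
    by (intro subsetD[OF assms(3)] relcompI) (fact that)+
  show "F O F \<subseteq> E" using E refl by blast
  show "F \<subseteq> E"
  proof (rule subrelI)
    fix x y assume "(x, y) \<in> F"
    with refl[OF this] E[of x y y y] show "(x, y) \<in> E" by blast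
  qed
qed

text \<open>Strips the buffers that \<open>valley_subset\<close> puts around a chain:
  \<open>F\<close> contains the trivial steps at both end points.\<close>

lemma uniformity_on_sandwich:
  assumes U: "uniformity_on X \<U>" and F: "F \<in> \<U>" and V: "V \<subseteq> X \<times> X" and FVF: "F O V O F \<subseteq> E"
  shows "F O V \<subseteq> E" "V \<subseteq> E"
proof -
  have E: "(x, y) \<in> E" if "(x, a) \<in> F" "(a, b) \<in> V" "(b, y) \<in> F" for x a b y
    by (intro subsetD[OF FVF] relcompI) (fact that)+
  show "F O V \<subseteq> E"
    using E V uniformity_on_refl[OF U F] by blast
  show "V \<subseteq> E"
  proof (rule subrelI)
    fix x y assume xy: "(x, y) \<in> V"
    then have "(x, x) \<in> F" "(y, y) \<in> F" using V uniformity_on_refl[OF U F] by blast+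
    with xy E show "(x, y) \<in> E" by blast
  qed
qed

section \<open>Uniform direct limits of towers\<close>

text \<open>The summand \<open>Id_on\<close> lets a chain turn around at any stage: a point of \<open>X (Suc n)\<close> need not be
  close to \<open>X n\<close>.\<close>

fun valley :: "(nat \<Rightarrow> 'a set) \<Rightarrow> (nat \<Rightarrow> ('a \<times> 'a) set) \<Rightarrow> nat \<Rightarrow> ('a \<times> 'a) set" where
  "valley X E 0 = E 0"
| "valley X E (Suc n) = E (Suc n) O (Id_on (X (Suc n)) \<union> valley X E n) O E (Suc n)"

lemma valley_SucE:
  assumes "(x, y) \<in> valley X E (Suc n)"
  obtains a b where "(x, a) \<in> E (Suc n)" "a = b \<or> (a, b) \<in> valley X E n" "(b, y) \<in> E (Suc n)"
  using assms unfolding valley.simps by (elim relcompEpair UnE) blast+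

lemma valley_mono:
  assumes "\<And>n. E n \<subseteq> F n"
  shows "valley X E n \<subseteq> valley X F n"
proof (induction n)
  case (Suc n)
  then show ?case unfolding valley.simps by (intro relcomp_mono Un_mono order_refl assms)
qed (simp add: assms)

lemma valley_converse: "(valley X E n)\<inverse> = valley X (\<lambda>n. (E n)\<inverse>) n"
  by (induction n) (simp_all add: converse_relcomp O_assoc converse_Un)

text \<open>The outer factors are buffers that carry the induction. An outermost step, of stage
  \<open>Suc n\<close>, lies in \<open>F (Suc (Suc n))\<close>; together with the buffer next to it,
  from the same entourage, it fits into \<open>F (Suc n)\<close>, the buffer of the chain one stage
  lower. Steps are thus absorbed from the outside inwards, the finest ones belonging to the highest
  stages. The cube enters at stage 0, where a single step lies between two buffers.\<close>

lemma valley_subset: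
  assumes "\<And>i. i \<le> n \<Longrightarrow> D i \<subseteq> F (Suc i)"
    and cube: "\<And>k. F (Suc k) O F (Suc k) O F (Suc k) \<subseteq> F k"
    and square: "\<And>k. F (Suc k) O F (Suc k) \<subseteq> F k"
    and decseq: "\<And>k. F (Suc k) \<subseteq> F k"
  shows "F (Suc n) O valley X D n O F (Suc n) \<subseteq> F 0"
  using assms(1)
proof (induction n)
  case 0
  have "F (Suc 0) O D 0 O F (Suc 0) \<subseteq> F (Suc 0) O F (Suc 0) O F (Suc 0)"
    using 0 by (intro relcomp_mono order_refl) auto
  with cube[of 0] show ?case by simp
next
  case (Suc n)
  have IH: "F (Suc n) O valley X D n O F (Suc n) \<subseteq> F 0" using Suc by simp
  have D: "D (Suc n) \<subseteq> F (Suc (Suc n))" using Suc.prems by simp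
  have F0: "F k \<subseteq> F 0" for k using lift_Suc_antimono_le[of F 0 k] decseq by simp
  let ?G = "F (Suc (Suc n))"
  have G: "?G O D (Suc n) \<subseteq> F (Suc n)" "D (Suc n) O ?G \<subseteq> F (Suc n)"
    using D square[of "Suc n"] by blast+
  show ?case
  proof
    fix p assume "p \<in> ?G O valley X D (Suc n) O ?G"
    then obtain x c e y where q: "p = (x, y)" "(x, c) \<in> ?G" "(c, e) \<in> valley X D (Suc n)"
      "(e, y) \<in> ?G"
      by (rule relcomp3E)
    from q(3) obtain a b where r: "(c, a) \<in> D (Suc n)" "a = b \<or> (a, b) \<in> valley X D n"
      "(b, e) \<in> D (Suc n)" by (rule valley_SucE)
    have p: "(x, a) \<in> F (Suc n)" "(b, y) \<in> F (Suc n)"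
      using q r G by blast+
    show "p \<in> F 0"
    proof (cases "a = b")
      case True
      then have "(x, y) \<in> F n" using p square[of n] by blast
      then show ?thesis using q(1) F0[of n] by blast
    next
      case False
      then have "(a, b) \<in> valley X D n" using r(2) by blast
      then show ?thesis using p q(1) IH by blast
    qed
  qed
qed

text \<open>\<open>restrict\<close> is uniform continuity of the inclusion into the next stage; with
  \<open>extend\<close> each stage carries exactly the subspace uniformity. \<open>extend\<close> is
  what lets \<open>refinement\<close> choose steps of the next stage whose traces are small in the
  present one.\<close>

locale uniform_tower =
  fixes X :: "nat \<Rightarrow> 'a set" and \<U> :: "nat \<Rightarrow> ('a \<times> 'a) set set"
  assumes uniformity: "uniformity_on (X n) (\<U> n)"
    and subset_Suc: "X n \<subseteq> X (Suc n)"
    and restrict: "E \<in> \<U> (Suc n) \<Longrightarrow> E \<inter> X n \<times> X n \<in> \<U> n"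
    and extend: "E \<in> \<U> n \<Longrightarrow> \<exists>H\<in>\<U> (Suc n). H \<inter> X n \<times> X n \<subseteq> E"
begin

abbreviation "limit \<equiv> uniform_direct_limit X \<U>"

lemma X_mono: "n \<le> m \<Longrightarrow> X n \<subseteq> X m"
  using lift_Suc_mono_le[of X] subset_Suc by blast

lemma entourage_subset: "E \<in> \<U> n \<Longrightarrow> E \<subseteq> X n \<times> X n"
  by (rule uniformity_onD(2)[OF uniformity])

lemma limit_uniformity: "uniformity_on (\<Union>n. X n) limit"
  using uniform_direct_limit_greatest(1)[of X \<U>, OF uniformity] by blast

lemma limit_restrict:
  assumes "E \<in> limit"
  shows "E \<inter> X n \<times> X n \<in> \<U> n"
proof -
  have "{(x, y) \<in> X n \<times> X n. (x, y) \<in> E} \<in> \<U> n"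
    using uniform_direct_limit_greatest(1)[of X \<U>, OF uniformity] assms
    unfolding uniformly_continuous_map_def by blast
  moreover have "{(x, y) \<in> X n \<times> X n. (x, y) \<in> E} = E \<inter> X n \<times> X n" by auto
  ultimately show ?thesis by simp
qed

section \<open>Descending-ascending chains as a base of the limit uniformity\<close>

lemma valley_carrier:
  assumes "\<And>n. E n \<in> \<U> n"
  shows "valley X E n \<subseteq> X n \<times> X n"
proof (induction n)
  case 0
  show ?case using assms entourage_subset by simp
next
  case (Suc n)
  have "E (Suc n) \<subseteq> X (Suc n) \<times> X (Suc n)" using assms entourage_subset by blast
  then show ?case by (auto elim!: valley_SucE simp del: valley.simps)
qed

lemma entourage_subset_valley:
  assumes "\<And>n. E n \<in> \<U> n"
  shows "E n \<subseteq> valley X E n"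
proof (cases n)
  case (Suc m)
  show ?thesis
  proof (rule subrelI)
    fix x y assume xy: "(x, y) \<in> E n"
    then have "y \<in> X n" using assms entourage_subset by blast
    then have "(y, y) \<in> E n" "(y, y) \<in> Id_on (X n)"
      using uniformity_on_refl[OF uniformity assms] by auto
    with xy show "(x, y) \<in> valley X E n" unfolding Suc valley.simps by blast
  qed
qed simp

lemma valley_subset_Suc:
  assumes "\<And>n. E n \<in> \<U> n"
  shows "valley X E n \<subseteq> valley X E (Suc n)"
proof (rule subrelI)
  fix x y assume xy: "(x, y) \<in> valley X E n"
  then have "x \<in> X (Suc n)" "y \<in> X (Suc n)"
    using valley_carrier[OF assms, of n] subset_Suc[of n] by blast+
  then have "(x, x) \<in> E (Suc n)" "(y, y) \<in> E (Suc n)"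
    using uniformity_on_refl[OF uniformity assms] by auto
  with xy show "(x, y) \<in> valley X E (Suc n)" unfolding valley.simps by blast
qed

lemma valley_le:
  assumes "\<And>n. E n \<in> \<U> n" "n \<le> m"
  shows "valley X E n \<subseteq> valley X E m"
  using lift_Suc_mono_le[of "valley X E"] valley_subset_Suc[OF assms(1)] assms(2) by blast

text \<open>The choice runs upwards. The entourage \<open>E\<close> already chosen at stage
  \<open>n\<close> contains the trace of some \<open>H\<close> from the next stage, and the next
  choice has its fifth power inside both \<open>H\<close> and \<open>D (Suc n)\<close>. The cube
  lies in the fifth power, so the trace condition follows.\<close>

lemma refinement:
  assumes D: "\<And>n. D n \<in> \<U> n"
  obtains F where "\<And>n. F n \<in> \<U> n"
    "\<And>n. F n O F n O F n O F n O F n \<subseteq> D n"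
    "\<And>n. (F (Suc n) O F (Suc n) O F (Suc n)) \<inter> X n \<times> X n \<subseteq> F n"
proof -
  let ?five = "\<lambda>E. E O E O E O E O E"
  have "\<exists>F. \<forall>n. (F n \<in> \<U> n \<and> ?five (F n) \<subseteq> D n) \<and>
      (F (Suc n) O F (Suc n) O F (Suc n)) \<inter> X n \<times> X n \<subseteq> F n"
  proof (rule dependent_nat_choice)
    show "\<exists>F. F \<in> \<U> 0 \<and> ?five F \<subseteq> D 0"
      using uniformity_on_fivefold[OF uniformity D] by blast
  next
    fix E n assume "E \<in> \<U> n \<and> ?five E \<subseteq> D n"
    then obtain H where H: "H \<in> \<U> (Suc n)" "H \<inter> X n \<times> X n \<subseteq> E" using extend by blast
    have "H \<inter> D (Suc n) \<in> \<U> (Suc n)" using uniformity_onD(5)[OF uniformity] H(1) D by blast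
    then obtain F where F: "F \<in> \<U> (Suc n)" "?five F \<subseteq> H \<inter> D (Suc n)"
      using uniformity_on_fivefold[OF uniformity] by blast
    have "F O F O F \<subseteq> ?five F" by (rule uniformity_on_cube_of_fivefold[OF uniformity F(1)])
    then show "\<exists>F. (F \<in> \<U> (Suc n) \<and> ?five F \<subseteq> D (Suc n)) \<and> (F O F O F) \<inter> X n \<times> X n \<subseteq> E"
      using F H by blast
  qed
  with that show thesis by blast
qed

text \<open>The middle factor is the link at the summit of a peak. Chains that meet in a point need
  a trivial link only; the general link is what the induction on the height of the summit produces
  one stage lower.\<close>

lemma valley_comp:
  assumes D: "\<And>n. D n \<in> \<U> n" and F: "\<And>n. F n \<in> \<U> n"
    and five: "\<And>n. F n O F n O F n O F n O F n \<subseteq> D n"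
    and three: "\<And>n. (F (Suc n) O F (Suc n) O F (Suc n)) \<inter> X n \<times> X n \<subseteq> F n"
  shows "valley X F n O F n O valley X F n \<subseteq> valley X D n"
proof -
  have D5: "(u, w) \<in> D n" if "(u, a) \<in> F n" "(a, b) \<in> F n" "(b, c) \<in> F n" "(c, d) \<in> F n" "(d, w) \<in> F n"
    for u a b c d w n
    by (intro subsetD[OF five] relcompI) (fact that)+
  have car: "u \<in> X n \<and> v \<in> X n" if "(u, v) \<in> F n" for u v n
    using that F entourage_subset by blast
  have refl: "(u, u) \<in> F n" if "u \<in> X n" for u n
    using that uniformity_on_refl[OF uniformity F] by blast
  have D1: "(u, v) \<in> D n" if "(u, v) \<in> F n" for u v n
    using D5[OF that] refl car[OF that] by blast
  have VF: "valley X F n \<subseteq> X n \<times> X n" for n using valley_carrier F by blast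
  have VD: "valley X F n \<subseteq> valley X D n" for n
    by (rule valley_mono) (use D1 in auto)
  show ?thesis
  proof (induction n)
    case 0
    show ?case
    proof
      fix p assume "p \<in> valley X F 0 O F 0 O valley X F 0"
      then obtain x a b y where p: "p = (x, y)" "(x, a) \<in> F 0" "(a, b) \<in> F 0" "(b, y) \<in> F 0"
        by auto
      then have "(x, y) \<in> D 0" using D5[OF p(2-4)] refl[of y] car[OF p(4)] by blast
      then show "p \<in> valley X D 0" using p(1) by simp
    qed
  next
    case (Suc n)
    let ?K = "F (Suc n)" and ?V = "valley X D (Suc n)"
    show ?case
    proof
      fix p assume "p \<in> valley X F (Suc n) O ?K O valley X F (Suc n)"
      then obtain x c d y where p: "p = (x, y)" "(x, c) \<in> valley X F (Suc n)" "(c, d) \<in> ?K"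
        "(d, y) \<in> valley X F (Suc n)" by (rule relcomp3E)
      from p(2) obtain a b where l: "(x, a) \<in> ?K" "a = b \<or> (a, b) \<in> valley X F n" "(b, c) \<in> ?K"
        by (rule valley_SucE)
      from p(4) obtain e g where r: "(d, e) \<in> ?K" "e = g \<or> (e, g) \<in> valley X F n" "(g, y) \<in> ?K"
        by (rule valley_SucE)
      have VI: "(x, y) \<in> ?V" if "(x, u) \<in> D (Suc n)" "(u, v) \<in> valley X D n" "(v, y) \<in> D (Suc n)" for u v
        using that by auto
      \<comment> \<open>The cases record which chains turn around at the top stage. A chain that
        turns is swallowed, together with the link and the adjacent step of the other chain, by one
        \<open>D\<close>-step; a chain that goes deeper survives as the lower part of the new
        valley.\<close>
      consider "a = b" "e = g" | "a = b" "(e, g) \<in> valley X F n"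
        | "(a, b) \<in> valley X F n" "e = g" | "(a, b) \<in> valley X F n" "(e, g) \<in> valley X F n"
        using l r by blast
      then have "(x, y) \<in> ?V"
      proof cases
        case 1
        then have "(x, y) \<in> D (Suc n)" using D5 l r p(3) by blast
        then show ?thesis using entourage_subset_valley[OF D, of "Suc n"] by blast
      next
        case 2
        have "(x, e) \<in> D (Suc n)"
          using D5[OF l(1) _ p(3) r(1) refl] 2 l r car by blast
        then show ?thesis using VI[of e g] 2 r(3) VD D1 by blast
      next
        case 3
        have "(b, y) \<in> D (Suc n)"
          using D5[OF l(3) p(3) r(1) _ refl] 3 l r car by blast
        then show ?thesis using VI[of a b] 3 l(1) VD D1 by blast
      next
        case 4
        \<comment> \<open>Both \<open>b\<close> and \<open>e\<close> lie in \<open>X n\<close>, so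
          the three steps across the summit form a link for the induction hypothesis.\<close>
        have "(b, e) \<in> ?K O ?K O ?K" using l p r by blast
        then have "(b, e) \<in> F n" using three 4 VF by blast
        then have "(a, g) \<in> valley X D n" using Suc 4 by blast
        then show ?thesis using VI[of a g] l r D1 by blast
      qed
      then show "p \<in> ?V" using p(1) by simp
    qed
  qed
qed

text \<open>The limit is the greatest uniformity with uniformly continuous inclusions, so it
  suffices to place the union in one such uniformity. The candidate \<open>\<W>\<close> is generated
  by unions of valleys; its substantial axiom is the one on squares, which rests on
  \<open>refinement\<close> and \<open>valley_comp\<close>.\<close>

lemma valley_in_limit:
  assumes D: "\<And>n. D n \<in> \<U> n"
  shows "(\<Union>n. valley X D n) \<in> limit"
proof -
  let ?Y = "\<Union>n. X n"
  define \<W> where "\<W> = {R. R \<subseteq> ?Y \<times> ?Y \<and> (\<exists>E. (\<forall>n. E n \<in> \<U> n) \<and> (\<forall>n. valley X E n \<subseteq> R))}"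
  have WI: "R \<in> \<W>" if "R \<subseteq> ?Y \<times> ?Y" "\<And>n. E n \<in> \<U> n" "\<And>n. valley X E n \<subseteq> R" for R E
    unfolding \<W>_def using that by blast
  have WE: "R \<subseteq> ?Y \<times> ?Y" "\<exists>E. (\<forall>n. E n \<in> \<U> n) \<and> (\<forall>n. valley X E n \<subseteq> R)" if "R \<in> \<W>" for R
    using that unfolding \<W>_def by blast+
  have hull: "valley X E n \<subseteq> ?Y \<times> ?Y" if "\<And>n. E n \<in> \<U> n" for E n
    using valley_carrier[OF that, of n] by blast
  have "uniformity_on ?Y \<W>"
    unfolding uniformity_on_def
  proof (intro conjI ballI allI impI)
    show "?Y \<times> ?Y \<in> \<W>" using D hull[OF D] by (intro WI[of _ D] order_refl)
  next
    fix R assume "R \<in> \<W>" then show "R \<subseteq> ?Y \<times> ?Y" by (rule WE)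
  next
    fix R assume "R \<in> \<W>"
    then obtain E where E: "\<And>n. E n \<in> \<U> n" "\<And>n. valley X E n \<subseteq> R" using WE(2)[of R] by blast
    then have "E n \<subseteq> R" for n using entourage_subset_valley by blast
    then show "Id_on ?Y \<subseteq> R" using uniformity_on_refl[OF uniformity E(1)] by blast
  next
    fix R S assume "R \<in> \<W>" and S: "R \<subseteq> S \<and> S \<subseteq> ?Y \<times> ?Y"
    then obtain E where E: "\<And>n. E n \<in> \<U> n" "\<And>n. valley X E n \<subseteq> R" using WE(2)[of R] by blast
    show "S \<in> \<W>" by (rule WI[of _ E]) (use S E in blast)+
  next
    fix R S assume "R \<in> \<W>" "S \<in> \<W>"
    then obtain E F where *: "R \<subseteq> ?Y \<times> ?Y" "\<And>n. E n \<in> \<U> n" "\<And>n. valley X E n \<subseteq> R"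
      "\<And>n. F n \<in> \<U> n" "\<And>n. valley X F n \<subseteq> S"
      using WE(2)[of R] WE(2)[of S] WE(1)[of R] by blast
    have "valley X (\<lambda>n. E n \<inter> F n) n \<subseteq> R \<inter> S" for n
      using *(3,5)[of n] valley_mono[of "\<lambda>n. E n \<inter> F n" E X n] valley_mono[of "\<lambda>n. E n \<inter> F n" F X n]
      by blast
    moreover have "E n \<inter> F n \<in> \<U> n" for n
      by (rule uniformity_onD(5)[OF uniformity *(2,4)])
    moreover have "R \<inter> S \<subseteq> ?Y \<times> ?Y" using *(1) by blast
    ultimately show "R \<inter> S \<in> \<W>" by (intro WI[of _ "\<lambda>n. E n \<inter> F n"])
  next
    fix R assume "R \<in> \<W>"
    then obtain E where *: "R \<subseteq> ?Y \<times> ?Y" "\<And>n. E n \<in> \<U> n" "\<And>n. valley X E n \<subseteq> R"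
      using WE(2)[of R] WE(1)[of R] by blast
    have "valley X (\<lambda>n. (E n)\<inverse>) n \<subseteq> R\<inverse>" for n
      using *(3)[of n] unfolding valley_converse[symmetric] by blast
    moreover have "(E n)\<inverse> \<in> \<U> n" for n by (rule uniformity_onD(6)[OF uniformity *(2)])
    moreover have "R\<inverse> \<subseteq> ?Y \<times> ?Y" using *(1) by blast
    ultimately show "R\<inverse> \<in> \<W>" by (intro WI[of _ "\<lambda>n. (E n)\<inverse>"])
  next
    fix R assume "R \<in> \<W>"
    then obtain E where E: "\<And>n. E n \<in> \<U> n" "\<And>n. valley X E n \<subseteq> R" using WE(2)[of R] by blast
    obtain F where F: "\<And>n. F n \<in> \<U> n" "\<And>n. F n O F n O F n O F n O F n \<subseteq> E n"
      "\<And>n. (F (Suc n) O F (Suc n) O F (Suc n)) \<inter> X n \<times> X n \<subseteq> F n"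
      using refinement[of E, OF E(1)] by blast
    let ?S = "\<Union>n. valley X F n"
    have "?S \<in> \<W>"
    proof (rule WI)
      show "F n \<in> \<U> n" for n by (rule F(1))
      show "?S \<subseteq> ?Y \<times> ?Y" using hull[OF F(1)] by (rule UN_least)
    qed (rule UN_upper[OF UNIV_I])
    moreover have "?S O ?S \<subseteq> R"
    proof
      fix p assume "p \<in> ?S O ?S"
      then obtain x y z where q: "p = (x, z)" "(x, y) \<in> ?S" "(y, z) \<in> ?S" by (rule relcompE)
      then obtain n m where p: "(x, y) \<in> valley X F n" "(y, z) \<in> valley X F m" by blast
      let ?k = "max n m"
      have k: "(x, y) \<in> valley X F ?k" "(y, z) \<in> valley X F ?k"
        using p valley_le[OF F(1), of n ?k] valley_le[OF F(1), of m ?k] by auto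
      then have "y \<in> X ?k" using valley_carrier[OF F(1)] by blast
      \<comment> \<open>The two chains, lifted to a common stage \<open>?k\<close>, meet in
        \<open>y\<close> and receive the trivial link there.\<close>
      then have "(y, y) \<in> F ?k" using uniformity_on_refl[OF uniformity F(1)] by blast
      with k have "(x, z) \<in> valley X F ?k O F ?k O valley X F ?k" by blast
      then have "(x, z) \<in> valley X E ?k" using valley_comp[OF E(1) F, of ?k] by blast
      then show "p \<in> R" using E(2) q(1) by blast
    qed
    ultimately show "\<exists>S\<in>\<W>. S O S \<subseteq> R" by blast
  qed
  moreover have "uniformly_continuous_map (X n) (\<U> n) ?Y \<W> (\<lambda>x. x)" for n
    unfolding uniformly_continuous_map_def
  proof (intro conjI ballI)
    fix R assume "R \<in> \<W>"
    then obtain E where E: "\<And>n. E n \<in> \<U> n" "\<And>n. valley X E n \<subseteq> R" using WE(2)[of R] by blast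
    have "E n \<subseteq> {(x, y) \<in> X n \<times> X n. (x, y) \<in> R}"
      using E entourage_subset_valley[of E n, OF E(1)] entourage_subset[OF E(1)] by blast
    then show "{(x, y) \<in> X n \<times> X n. (x, y) \<in> R} \<in> \<U> n"
      by (rule uniformity_onD(4)[OF uniformity E(1)]) blast
  qed blast
  ultimately have "\<W> \<subseteq> limit"
    by (intro uniform_direct_limit_greatest(2)[OF uniformity] conjI allI)
  moreover have "(\<Union>n. valley X D n) \<in> \<W>"
  proof (rule WI)
    show "D n \<in> \<U> n" for n by (rule D)
    show "(\<Union>n. valley X D n) \<subseteq> ?Y \<times> ?Y" using hull[OF D] by (rule UN_least)
  qed (rule UN_upper[OF UNIV_I])
  ultimately show ?thesis by blast
qed

text \<open>Traces of limit entourages are stage entourages, and the traces of a cube sequence for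
  \<open>E\<close> shrink fast enough for \<open>valley_subset\<close>. With
  \<open>valley_in_limit\<close> this makes the unions of valleys a base of the limit
  uniformity.\<close>

lemma limit_valley:
  assumes E: "E \<in> limit"
  obtains D where "\<And>n. D n \<in> \<U> n" "\<And>n. valley X D n \<subseteq> E"
proof -
  obtain F where F: "\<And>k. F k \<in> limit" "F 0 = E"
      "\<And>k. F (Suc k) O F (Suc k) O F (Suc k) \<subseteq> F k"
    using uniformity_on_cube_sequence[OF limit_uniformity E] by blast
  note sq = uniformity_on_cube_square[OF limit_uniformity F(1) F(3)]
  define D where "D = (\<lambda>n. F (Suc n) \<inter> X n \<times> X n)"
  have D: "D n \<in> \<U> n" for n unfolding D_def using limit_restrict F(1) by blast
  have "valley X D n \<subseteq> E" for n
  proof -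
    have "F (Suc n) O valley X D n O F (Suc n) \<subseteq> E"
      using valley_subset[of n D F X] sq F(2,3) unfolding D_def by blast
    moreover have "valley X D n \<subseteq> (\<Union>n. X n) \<times> (\<Union>n. X n)"
      using valley_carrier[of D n, OF D] by blast
    ultimately show ?thesis by (rule uniformity_on_sandwich(2)[OF limit_uniformity F(1), rotated])
  qed
  with D that show thesis by blast
qed

text \<open>One-sided version of the absorption in \<open>valley_subset\<close>, with
  \<open>Q k\<close> standing for the translate of a product of \<open>k + 1\<close> factors. The
  entourage \<open>D i\<close> lives at stage \<open>max n i\<close> because the starting point is
  only known to lie in \<open>X n\<close>, so the \<open>i\<close>-th step may have to be made at a
  stage above \<open>i\<close>.\<close>

lemma limit_ascending_chains:
  assumes E: "E \<in> limit"
  obtains D where "\<And>i. D i \<in> \<U> (max n i)"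
    "\<And>Q y k. Q 0 \<subseteq> D 0 `` {y} \<Longrightarrow> (\<And>k. Q (Suc k) \<subseteq> D (Suc k) `` Q k) \<Longrightarrow> Q k \<subseteq> E `` {y}"
proof -
  obtain F where F: "\<And>k. F k \<in> limit" "F 0 = E"
      "\<And>k. F (Suc k) O F (Suc k) O F (Suc k) \<subseteq> F k"
    using uniformity_on_cube_sequence[OF limit_uniformity E] by blast
  note sq = uniformity_on_cube_square[OF limit_uniformity F(1) F(3)]
  define D where "D = (\<lambda>i. F (Suc i) \<inter> X (max n i) \<times> X (max n i))"
  have D: "D i \<in> \<U> (max n i)" for i unfolding D_def using limit_restrict F(1) by blast
  have "Q k \<subseteq> E `` {y}"
    if Q: "Q 0 \<subseteq> D 0 `` {y}" "\<And>k. Q (Suc k) \<subseteq> D (Suc k) `` Q k" for Q y k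
  proof -
    have "F (Suc k) `` Q k \<subseteq> E `` {y}"
    proof (induction k)
      case 0
      have "F (Suc 0) `` Q 0 \<subseteq> (F (Suc 0) O F (Suc 0)) `` {y}" using Q(1) unfolding D_def by blast
      then show ?case using sq(1)[of 0] F(2) by blast
    next
      case (Suc k)
      have "F (Suc (Suc k)) `` Q (Suc k) \<subseteq> (F (Suc (Suc k)) O F (Suc (Suc k))) `` Q k"
        using Q(2)[of k] unfolding D_def by blast
      then show ?case using Suc sq(1)[of "Suc k"] by blast
    qed
    moreover have "Q k \<subseteq> (\<Union>n. X n)"
      using Q(1) Q(2)[of "k - 1"] unfolding D_def by (cases k) auto
    moreover have "Id_on (\<Union>n. X n) \<subseteq> F (Suc k)"
      using F(1) uniformity_onD(3)[OF limit_uniformity] by blast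
    ultimately show ?thesis by blast
  qed
  with D that show thesis by blast
qed

text \<open>Turns ascending chains from a fixed point into a neighbourhood: a two-sided chain that
  starts at \<open>y\<close> ends in some \<open>Q k\<close>, because its descending half can be
  absorbed as long as it stays at stages containing \<open>y\<close>, and everything below is
  collapsed into one step.\<close>

lemma limit_nbhd:
  assumes D: "\<And>k. D k \<in> \<U> k" and y: "y \<in> X n" "y \<in> Q n"
    and Q: "\<And>k. n \<le> k \<Longrightarrow> D (Suc k) `` Q k \<subseteq> Q (Suc k)"
  obtains E where "E \<in> limit" "E `` {y} \<subseteq> (\<Union>k. Q k)"
proof -
  \<comment> \<open>One step of \<open>D ?N\<close> from \<open>y\<close>, which lies in
    \<open>Q n\<close>, leads into \<open>Q ?N\<close>; this is the first use of the closure
    assumption on \<open>Q\<close>.\<close>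
  let ?N = "Suc n"
  obtain F where F: "\<And>k. F k \<in> \<U> ?N" "F 0 = D ?N"
      "\<And>k. F (Suc k) O F (Suc k) O F (Suc k) \<subseteq> F k"
    using uniformity_on_cube_sequence[OF uniformity D[of ?N]] by blast
  note sq = uniformity_on_cube_square[OF uniformity F(1) F(3)]
  have low: "H \<inter> X i \<times> X i \<in> \<U> i" if "H \<in> \<U> j" "i \<le> j" for H i j
    using that(2,1)
  proof (induction arbitrary: H rule: dec_induct)
    case base
    have "H \<inter> X i \<times> X i = H" using base entourage_subset by blast
    then show ?case using base by simp
  next
    case (step j)
    have "(H \<inter> X j \<times> X j) \<inter> X i \<times> X i \<in> \<U> i" using step restrict by blast
    moreover have "(H \<inter> X j \<times> X j) \<inter> X i \<times> X i = H \<inter> X i \<times> X i"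
      using X_mono step by blast
    ultimately show ?case by simp
  qed
  \<comment> \<open>Up to \<open>?N\<close> the traces of \<open>F\<close> make every chain collapse
    into the single entourage \<open>D ?N\<close>. Above \<open>?N\<close> the given
    \<open>D\<close> is kept, one ascending step for each stage.\<close>
  define C where "C = (\<lambda>i. if i \<le> ?N then F (Suc i) \<inter> X i \<times> X i else D i)"
  have C: "C i \<in> \<U> i" for i unfolding C_def using low F(1) D by auto
  obtain E where E: "\<And>n. E n \<in> \<U> n" "\<And>n. E n O E n O E n O E n O E n \<subseteq> C n"
      "\<And>n. (E (Suc n) O E (Suc n) O E (Suc n)) \<inter> X n \<times> X n \<subseteq> E n"
    using refinement[of C, OF C] by blast
  have E3: "E k O E k O E k \<subseteq> C k" for k
    using uniformity_on_cube_of_fivefold[OF uniformity E(1)] E(2)[of k] by blast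
  have E1: "E k \<subseteq> C k" for k by (rule uniformity_on_cube_square[OF uniformity E(1) E3])
  have E2: "(E (Suc k) O E (Suc k)) \<inter> X k \<times> X k \<subseteq> E k" for k
    using uniformity_on_cube_square(1)[OF uniformity E(1) order_refl, of "Suc k"] E(3)[of k] by blast
  have yX: "y \<in> X k" if "n \<le> k" for k using that y X_mono by blast
  have yQ: "y \<in> Q k" if "n \<le> k" for k using that
  proof (induction rule: dec_induct)
    case (step k)
    have "(y, y) \<in> D (Suc k)" using uniformity_on_refl[OF uniformity D] yX step by simp
    then show ?case using Q[of k] step by blast
  qed (rule y(2))
  \<comment> \<open>The leading factor \<open>E k\<close> allows the chain to start near
    \<open>y\<close> instead of at \<open>y\<close>; it holds the descent absorbed so far.\<close>
  have main: "(E k O valley X E k) `` {y} \<subseteq> Q k" if "?N \<le> k" for k using that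
  proof (induction rule: dec_induct)
    case base
    have EF: "E i \<subseteq> F (Suc i)" if "i \<le> ?N" for i using E1[of i] that unfolding C_def by auto
    have "F (Suc ?N) O valley X E ?N O F (Suc ?N) \<subseteq> D ?N"
      unfolding F(2)[symmetric] using EF F(3) sq by (rule valley_subset)
    moreover have "valley X E ?N \<subseteq> X ?N \<times> X ?N" using valley_carrier[OF E(1)] .
    ultimately have "F (Suc ?N) O valley X E ?N \<subseteq> D ?N"
      by (rule uniformity_on_sandwich(1)[OF uniformity F(1), rotated])
    then have "E ?N O valley X E ?N \<subseteq> D ?N" using EF[OF order_refl] by blast
    then show ?case using Q[of n] yQ[of n] by blast
  next
    case (step k)
    have CD: "C (Suc k) = D (Suc k)" using step unfolding C_def by simp
    show ?case
    proof
      fix z assume "z \<in> (E (Suc k) O valley X E (Suc k)) `` {y}"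
      then obtain w where w: "(y, w) \<in> E (Suc k)" "(w, z) \<in> valley X E (Suc k)" by blast
      from w(2) obtain a b where z: "(w, a) \<in> E (Suc k)" "a = b \<or> (a, b) \<in> valley X E k"
        "(b, z) \<in> E (Suc k)" by (rule valley_SucE)
      show "z \<in> Q (Suc k)"
      proof (cases "a = b")
        case True
        then have "(y, z) \<in> E (Suc k) O E (Suc k) O E (Suc k)" using w z by blast
        then have "(y, z) \<in> D (Suc k)" using E3[of "Suc k"] CD by blast
        then show ?thesis using Q[of k] yQ[of k] step by auto
      next
        case False
        then have ab: "(a, b) \<in> valley X E k" using z by blast
        then have "a \<in> X k" using valley_carrier[OF E(1)] by blast
        \<comment> \<open>Two steps of stage \<open>Suc k\<close> between points of
          \<open>X k\<close> become the one admissible first step at stage \<open>k\<close>.\<close>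
        then have "(y, a) \<in> E k" using w z E2[of k] yX[of k] step by auto
        then have "b \<in> Q k" using ab step by blast
        then show ?thesis using z(3) E1[of "Suc k"] CD Q[of k] step by auto
      qed
    qed
  qed
  have "(\<Union>k. valley X E k) `` {y} \<subseteq> (\<Union>k. Q k)"
  proof
    fix z assume "z \<in> (\<Union>k. valley X E k) `` {y}"
    then obtain j where "(y, z) \<in> valley X E j" by blast
    then have "(y, z) \<in> valley X E (max j ?N)" using valley_le[OF E(1), of j "max j ?N"] by auto
    moreover have "(y, y) \<in> E (max j ?N)"
      using uniformity_on_refl[OF uniformity E(1)] yX by simp
    ultimately show "z \<in> (\<Union>k. Q k)" using main[of "max j ?N"] by auto
  qed
  then show thesis using that valley_in_limit[OF E(1)] by blast
qed

end

section \<open>Limits of pseudometrics\<close>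

text \<open>Inductive form of the sums in \<open>lim_pseudometric\<close>. The set \<open>S\<close>
  confines the points of a chain, so that a chain can be studied inside one stage, while the cost of
  a step depends only on its two end points.\<close>

inductive chain_cost ::
  "(nat \<Rightarrow> 'a set) \<Rightarrow> (nat \<Rightarrow> 'a \<Rightarrow> 'a \<Rightarrow> real) \<Rightarrow> 'a set \<Rightarrow> 'a \<Rightarrow> 'a \<Rightarrow> real \<Rightarrow> bool"
  for X d S x where
  refl: "x \<in> S \<Longrightarrow> chain_cost X d S x x 0"
| step: "chain_cost X d S x y s \<Longrightarrow> z \<in> S \<Longrightarrow>
    chain_cost X d S x z (s + d (level2 X y z) y z)"

lemma chain_cost_endpoints: "chain_cost X d S x y s \<Longrightarrow> x \<in> S \<and> y \<in> S"
  by (induction rule: chain_cost.induct) auto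

lemma chain_cost_mono: "chain_cost X d S x y s \<Longrightarrow> S \<subseteq> S' \<Longrightarrow> chain_cost X d S' x y s"
  by (induction rule: chain_cost.induct) (auto intro: chain_cost.intros)

lemma chain_cost_trans:
  assumes "chain_cost X d S y z t" "chain_cost X d S x y s"
  shows "chain_cost X d S x z (s + t)"
  using assms
proof (induction rule: chain_cost.induct)
  case (step z t w)
  then show ?case using chain_cost.step[of X d S x z "s + t" w] by (simp add: add.assoc)
qed simp

lemma chain_cost_single:
  assumes "x \<in> S" "y \<in> S"
  shows "chain_cost X d S x y (d (level2 X x y) x y)"
  using chain_cost.step[OF chain_cost.refl[OF assms(1)] assms(2)] by simp

lemma chain_cost_stage:
  assumes "\<And>n. X n \<subseteq> X (Suc n)" "chain_cost X d (\<Union>n. X n) x y s"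
  shows "\<exists>N. chain_cost X d (X N) x y s"
  using assms(2)
proof (induction rule: chain_cost.induct)
  case refl
  then show ?case by (auto intro: chain_cost.refl)
next
  case (step y s z)
  then obtain N M where "chain_cost X d (X N) x y s" "z \<in> X M" by blast
  moreover have "X N \<subseteq> X (max N M)" "X M \<subseteq> X (max N M)"
    using lift_Suc_mono_le[of X] assms(1) by simp_all
  ultimately have "chain_cost X d (X (max N M)) x y s" "z \<in> X (max N M)"
    by (auto intro: chain_cost_mono)
  then show ?case by (intro exI[of _ "max N M"] chain_cost.step)
qed

text \<open>The empty chain, which \<open>m \<ge> 1\<close> excludes, corresponds to the single step
  from \<open>x\<close> to \<open>x\<close>; the assumption makes that step free.\<close>

lemma lim_pseudometric_chain_cost:
  assumes "\<And>x. x \<in> (\<Union>n. X n) \<Longrightarrow> d (level2 X x x) x x = 0"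
  shows "lim_pseudometric X d x y = Inf {s. chain_cost X d (\<Union>n. X n) x y s}"
proof -
  let ?Y = "\<Union>n. X n"
  let ?c = "\<lambda>z (m::nat). \<Sum>i=1..m. d (level2 X (z (i - 1)) (z i)) (z (i - 1)) (z i)"
  have chain: "chain_cost X d ?Y (z 0) (z k) (?c z k)" if "\<forall>i\<le>m. z i \<in> ?Y" "k \<le> m" for z and m k :: nat
    using that(2)
  proof (induction k)
    case 0
    then show ?case using that(1) by (auto intro: chain_cost.refl)
  next
    case (Suc k)
    then show ?case using that(1) chain_cost.step[of X d ?Y "z 0" "z k" "?c z k" "z (Suc k)"] by simp
  qed
  have sum: "\<exists>m z. s = ?c z m \<and> m \<ge> 1 \<and> (\<forall>i\<le>m. z i \<in> ?Y) \<and> z 0 = x \<and> z m = y"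
    if "chain_cost X d ?Y x y s" for s
    using that
  proof (induction rule: chain_cost.induct)
    case refl
    then show ?case using assms by (intro exI[of _ 1] exI[of _ "\<lambda>_. x"]) simp
  next
    case (step y s w)
    then obtain m z where z: "s = ?c z m" "m \<ge> 1" "\<forall>i\<le>m. z i \<in> ?Y" "z 0 = x" "z m = y" by blast
    let ?z = "z(Suc m := w)"
    have "?c ?z m = ?c z m" by (intro sum.cong) auto
    then have "s + d (level2 X y w) y w = ?c ?z (Suc m)" using z by simp
    moreover have "\<forall>i\<le>Suc m. ?z i \<in> ?Y" using z step(2) by (auto simp: le_Suc_eq)
    ultimately show ?case using z by (intro exI[of _ "Suc m"] exI[of _ ?z]) simp
  qed
  have "{?c z m | (m::nat) z. m \<ge> 1 \<and> (\<forall>i\<le>m. z i \<in> ?Y) \<and> z 0 = x \<and> z m = y}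
      = {s. chain_cost X d ?Y x y s}"
  proof (intro Set.set_eqI iffI)
    fix s assume "s \<in> {?c z m | (m::nat) z. m \<ge> 1 \<and> (\<forall>i\<le>m. z i \<in> ?Y) \<and> z 0 = x \<and> z m = y}"
    then obtain m z where "s = ?c z m" "\<forall>i\<le>m. z i \<in> ?Y" "z 0 = x" "z m = y" by blast
    then show "s \<in> {s. chain_cost X d ?Y x y s}" using chain[of m z m] by simp
  next
    fix s assume "s \<in> {s. chain_cost X d ?Y x y s}"
    then show "s \<in> {?c z m | (m::nat) z. m \<ge> 1 \<and> (\<forall>i\<le>m. z i \<in> ?Y) \<and> z 0 = x \<and> z m = y}"
      using sum[of s] by blast
  qed
  then show ?thesis unfolding lim_pseudometric_def by simp
qed

section \<open>Cheap chains compared with descending-ascending chains\<close>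

locale monotone_pseudometric_tower = uniform_tower X \<U>
  for X :: "nat \<Rightarrow> 'a set" and \<U> +
  fixes d :: "nat \<Rightarrow> 'a \<Rightarrow> 'a \<Rightarrow> real"
  assumes d: "d \<in> monotone_pseudometrics X \<U>"
begin

abbreviation "Y \<equiv> (\<Union>n. X n)"

lemma level_le: "x \<in> X n \<Longrightarrow> level X x \<le> n"
  unfolding level_def by (rule Least_le)

lemma level2_le: "x \<in> X n \<Longrightarrow> y \<in> X n \<Longrightarrow> level2 X x y \<le> n"
  unfolding level2_def by (simp add: level_le)

lemma in_level: "x \<in> Y \<Longrightarrow> x \<in> X (level X x)"
  unfolding level_def by (auto intro: LeastI)

lemma in_level2:
  assumes "x \<in> Y" "y \<in> Y" "level2 X x y \<le> n"
  shows "x \<in> X n" "y \<in> X n"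
proof -
  have "level X x \<le> n" "level X y \<le> n" using assms(3) unfolding level2_def by simp_all
  then show "x \<in> X n" "y \<in> X n"
    using in_level[OF assms(1)] in_level[OF assms(2)] X_mono by blast+
qed

lemma d_pseudometric: "pseudometric_on (X n) (d n)"
  and d_entourage: "0 < \<epsilon> \<Longrightarrow> pseudometric_entourage (X n) (d n) \<epsilon> \<in> \<U> n"
  using d unfolding monotone_pseudometrics_def uniform_pseudometrics_def by blast+

lemma d_nonneg: "x \<in> X n \<Longrightarrow> y \<in> X n \<Longrightarrow> 0 \<le> d n x y"
  and d_commute: "x \<in> X n \<Longrightarrow> y \<in> X n \<Longrightarrow> d n x y = d n y x"
  and d_self: "x \<in> X n \<Longrightarrow> d n x x = 0"
  and d_triangle: "x \<in> X n \<Longrightarrow> y \<in> X n \<Longrightarrow> z \<in> X n \<Longrightarrow> d n x z \<le> d n x y + d n y z"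
  using d_pseudometric[of n] by (simp_all add: pseudometric_on_def)

lemma d_mono:
  assumes "n \<le> m" "x \<in> X n" "y \<in> X n"
  shows "d n x y \<le> d m x y"
  using assms(1)
proof (induction rule: dec_induct)
  case (step k)
  have "x \<in> X k" "y \<in> X k" using X_mono assms step by blast+
  then have "d k x y \<le> d (Suc k) x y" using d unfolding monotone_pseudometrics_def by blast
  then show ?case using step by simp
qed simp

text \<open>\<open>level2 X x y\<close> is the least stage containing both points and the
  pseudometrics grow with the stage, so a chain pays the cheapest available price for a step. This
  is where monotonicity of the sequence enters.\<close>

lemma step_le:
  assumes "x \<in> X n" "y \<in> X n"
  shows "d (level2 X x y) x y \<le> d n x y"
proof (rule d_mono)
  show "level2 X x y \<le> n" using assms by (rule level2_le)
  have "x \<in> Y" "y \<in> Y" using assms by auto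
  then show "x \<in> X (level2 X x y)" "y \<in> X (level2 X x y)" using in_level2 by blast+
qed

lemma chain_cost_nonneg: "chain_cost X d Y x y s \<Longrightarrow> 0 \<le> s"
proof (induction rule: chain_cost.induct)
  case (step y s z)
  then have "y \<in> Y" using chain_cost_endpoints[OF step.hyps(1)] by simp
  then have "0 \<le> d (level2 X y z) y z"
    using d_nonneg[OF in_level2[OF _ step.hyps(2) order_refl]] by blast
  then show ?case using step.IH by simp
qed simp

lemma chain_cost_commute: "chain_cost X d Y x y s \<Longrightarrow> chain_cost X d Y y x s"
proof (induction rule: chain_cost.induct)
  case (step y s z)
  have y: "y \<in> Y" using chain_cost_endpoints[OF step.hyps(1)] by simp
  have "level2 X z y = level2 X y z" unfolding level2_def by (rule max.commute)
  then have "d (level2 X z y) z y = d (level2 X y z) y z"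
    using d_commute[OF in_level2(2,1)[OF y step.hyps(2) order_refl]] by simp
  then have "chain_cost X d Y z y (d (level2 X y z) y z)"
    using chain_cost_single[OF step.hyps(2) y, of X d] by simp
  from chain_cost_trans[OF step.IH this] show ?case by (simp add: add.commute)
qed (rule chain_cost.refl)

lemma lim_eq: "lim_pseudometric X d x y = Inf {s. chain_cost X d Y x y s}"
proof (rule lim_pseudometric_chain_cost)
  show "d (level2 X x x) x x = 0" if "x \<in> Y" for x
    using in_level2[OF that that order_refl] by (intro d_self)
qed

lemma chain_costs_bdd_below: "bdd_below {s. chain_cost X d Y x y s}"
  using chain_cost_nonneg by (intro bdd_belowI[of _ 0]) auto

lemma lim_le: "chain_cost X d Y x y s \<Longrightarrow> lim_pseudometric X d x y \<le> s"
  unfolding lim_eq by (rule cInf_lower) (auto intro: chain_costs_bdd_below)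

lemma lim_greatest:
  assumes "x \<in> Y" "y \<in> Y" "\<And>s. chain_cost X d Y x y s \<Longrightarrow> c \<le> s"
  shows "c \<le> lim_pseudometric X d x y"
  unfolding lim_eq
  by (rule cInf_greatest) (use assms chain_cost_single[OF assms(1,2)] in blast)+

lemma lim_pseudometric: "pseudometric_on Y (lim_pseudometric X d)"
  unfolding pseudometric_on_def
proof (intro conjI ballI)
  fix x y assume xy: "x \<in> Y" "y \<in> Y"
  show "0 \<le> lim_pseudometric X d x y" using xy chain_cost_nonneg by (rule lim_greatest)
  show "lim_pseudometric X d x y = lim_pseudometric X d y x"
    unfolding lim_eq
    by (rule arg_cong[of _ _ Inf], rule Collect_cong) (rule iffI; rule chain_cost_commute)
next
  fix x assume x: "x \<in> Y"
  have "0 \<le> lim_pseudometric X d x x" using x x chain_cost_nonneg by (rule lim_greatest)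
  then show "lim_pseudometric X d x x = 0" using lim_le[OF chain_cost.refl[OF x]] by simp
next
  fix x y z assume *: "x \<in> Y" "y \<in> Y" "z \<in> Y"
  let ?l = "lim_pseudometric X d"
  \<comment> \<open>The two infima are taken one after the other: over chains from \<open>y\<close>
    to \<open>z\<close> with \<open>s\<close> fixed, then over \<open>s\<close>.\<close>
  have "?l x z - s \<le> ?l y z" if s: "chain_cost X d Y x y s" for s
  proof (rule lim_greatest[OF *(2,3)])
    fix t assume "chain_cost X d Y y z t"
    then have "?l x z \<le> s + t" using s by (intro lim_le chain_cost_trans)
    then show "?l x z - s \<le> t" by simp
  qed
  then have "?l x z - ?l y z \<le> s" if "chain_cost X d Y x y s" for s using that by fastforce
  then have "?l x z - ?l y z \<le> ?l x y" by (rule lim_greatest[OF *(1,2)])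
  then show "?l x z \<le> ?l x y + ?l y z" by simp
qed

text \<open>A step that uses a point outside \<open>X N\<close> is measured by \<open>d (Suc N)\<close>. So an excursion that leaves
  \<open>X N\<close> and comes back can be replaced by one step of no larger cost, because the step between two
  points of \<open>X N\<close> is measured at a lower stage.\<close>

lemma chain_cost_descend:
  assumes "chain_cost X d (X (Suc N)) x y s"
  shows "d (Suc N) x y \<le> s \<or>
    (\<exists>a\<in>X N. \<exists>b\<in>X N. \<exists>t. chain_cost X d (X N) a b t \<and> d (Suc N) x a + t + d (Suc N) b y \<le> s)"
    (is "_ \<or> ?P y s")
  using assms
proof (induction rule: chain_cost.induct)
  case refl
  then show ?case by (simp add: d_self)
next
  case (step y s z)
  let ?M = "Suc N" and ?L = "level2 X y z"
  have xyz: "x \<in> X ?M" "y \<in> X ?M" "z \<in> X ?M" using step chain_cost_endpoints[OF step.hyps(1)] by blast+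
  have N: "u \<in> X ?M" if "u \<in> X N" for u using that subset_Suc by blast
  show ?case
  proof (cases "?L \<le> N")
    case True
    then have yz: "y \<in> X N" "z \<in> X N" using in_level2[of y z N] xyz by blast+
    have z: "d ?M z z = 0" using d_self xyz by blast
    from step.IH have "?P z (s + d ?L y z)"
    proof
      assume "d ?M x y \<le> s"
      then have "d ?M x y + d ?L y z + d ?M z z \<le> s + d ?L y z" using z by simp
      then show ?thesis using yz chain_cost_single[OF yz] by blast
    next
      assume "?P y s"
      then obtain a b t where a: "a \<in> X N" "b \<in> X N" "chain_cost X d (X N) a b t"
        "d ?M x a + t + d ?M b y \<le> s" by blast
      \<comment> \<open>The old final step from \<open>b\<close> to \<open>y\<close> now joins
        points of \<open>X N\<close> and moves into the inner chain at no larger cost; the new final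
        step is the trivial one at \<open>z\<close>.\<close>
      have "chain_cost X d (X N) a z (t + d (level2 X b y) b y + d ?L y z)"
        using a(3) yz by (intro chain_cost.step)
      moreover have "d (level2 X b y) b y \<le> d ?M b y" using a yz by (intro step_le N)
      then have "d ?M x a + (t + d (level2 X b y) b y + d ?L y z) + d ?M z z \<le> s + d ?L y z"
        using a(4) z by simp
      ultimately show ?thesis using a(1) yz(2) by blast
    qed
    then show ?thesis ..
  next
    case False
    \<comment> \<open>A step measured at the top stage merges with the outer step before it by the
      triangle inequality.\<close>
    then have L: "?L = ?M" using level2_le[OF xyz(2,3)] by simp
    from step.IH show ?thesis
    proof
      assume "d ?M x y \<le> s"
      then show ?thesis using d_triangle[OF xyz] L by simp
    next
      assume "?P y s"
      then obtain a b t where a: "a \<in> X N" "b \<in> X N" "chain_cost X d (X N) a b t"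
        "d ?M x a + t + d ?M b y \<le> s" by blast
      have "d ?M b z \<le> d ?M b y + d ?M y z" using N[OF a(2)] xyz(2,3) by (rule d_triangle)
      then have "d ?M x a + t + d ?M b z \<le> s + d ?L y z" using a(4) L by simp
      then show ?thesis using a by blast
    qed
  qed
qed

text \<open>\<open>chain_cost_descend\<close> peels off the top stage. All costs are nonnegative, so
  a total below 1 keeps both outer steps and the remaining chain below 1; the same radius 1
  therefore serves at every stage.\<close>

lemma chain_cost_valley:
  assumes "chain_cost X d (X N) x y s" "s < 1"
  shows "(x, y) \<in> valley X (\<lambda>n. pseudometric_entourage (X n) (d n) 1) N"
  using assms
proof (induction N arbitrary: x y s)
  case 0
  have "d 0 x y \<le> s \<and> x \<in> X 0 \<and> y \<in> X 0"
    using 0(1)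
  proof (induction rule: chain_cost.induct)
    case refl
    then show ?case by (simp add: d_self)
  next
    case (step y s z)
    then have "level2 X y z = 0" using level2_le[of y 0 z] by simp
    then show ?case using step d_triangle[of x 0 y z] by simp
  qed
  then show ?case using 0(2) by (simp add: pseudometric_entourage_def)
next
  case (Suc N)
  let ?E = "\<lambda>n. pseudometric_entourage (X n) (d n) 1" and ?M = "Suc N"
  have xy: "x \<in> X ?M" "y \<in> X ?M" using chain_cost_endpoints[OF Suc.prems(1)] by blast+
  from chain_cost_descend[OF Suc.prems(1)] show ?case
  proof
    assume "d ?M x y \<le> s"
    then have "(x, y) \<in> ?E ?M" using xy Suc by (simp add: pseudometric_entourage_def)
    then show ?thesis using entourage_subset_valley[of ?E ?M] d_entourage by auto
  next
    assume "\<exists>a\<in>X N. \<exists>b\<in>X N. \<exists>t. chain_cost X d (X N) a b t \<and> d ?M x a + t + d ?M b y \<le> s"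
    then obtain a b t where a: "a \<in> X N" "b \<in> X N" "chain_cost X d (X N) a b t"
      "d ?M x a + t + d ?M b y \<le> s" by blast
    have ab: "a \<in> X ?M" "b \<in> X ?M" using a subset_Suc by blast+
    have "chain_cost X d Y a b t" using a(3) by (rule chain_cost_mono) blast
    then have "0 \<le> t" "0 \<le> d ?M x a" "0 \<le> d ?M b y"
      using chain_cost_nonneg d_nonneg[OF xy(1) ab(1)] d_nonneg[OF ab(2) xy(2)] by simp_all
    then have "t < 1" "(x, a) \<in> ?E ?M" "(b, y) \<in> ?E ?M"
      using a(4) Suc.prems(2) ab xy by (auto simp: pseudometric_entourage_def)
    then show ?thesis using Suc.IH[OF a(3)] unfolding valley.simps by blast
  qed
qed

lemma lim_entourage_subset_valley:
  "pseudometric_entourage Y (lim_pseudometric X d) 1 \<subseteq>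
     (\<Union>n. valley X (\<lambda>n. pseudometric_entourage (X n) (d n) 1) n)"
proof (rule subrelI)
  fix x y assume "(x, y) \<in> pseudometric_entourage Y (lim_pseudometric X d) 1"
  then have xy: "x \<in> Y" "y \<in> Y" "lim_pseudometric X d x y < 1"
    unfolding pseudometric_entourage_def by blast+
  then obtain s where "s < 1" "chain_cost X d Y x y s"
    using lim_greatest[OF xy(1,2), of 1] by (meson not_le)
  then show "(x, y) \<in> (\<Union>n. valley X (\<lambda>n. pseudometric_entourage (X n) (d n) 1) n)"
    using chain_cost_stage[of X d x y s, OF subset_Suc] chain_cost_valley[of _ x y s] by auto
qed

text \<open>From stage \<open>n\<close> to \<open>Suc n\<close> the bound grows by
  \<open>1 / 2 ^ (n + 2)\<close>, while the two new steps cost less than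
  \<open>2 / 4 ^ (n + 2)\<close>, which is smaller. Every bound stays strictly below 1, so the
  infimum over chains does too.\<close>

lemma valley_chain_cost:
  assumes "(x, y) \<in> valley X (\<lambda>n. pseudometric_entourage (X n) (d n) (1 / 4 ^ Suc n)) n"
  shows "\<exists>s. chain_cost X d Y x y s \<and> s < 1 - 1 / 2 ^ Suc n"
  using assms
proof (induction n arbitrary: x y)
  case 0
  then have xy: "x \<in> X 0" "y \<in> X 0" "d 0 x y < 1 / 4" by (auto simp: pseudometric_entourage_def)
  then have "chain_cost X d Y x y (d (level2 X x y) x y)" by (intro chain_cost_single) auto
  moreover have "d (level2 X x y) x y < 1 - 1 / 2 ^ Suc 0" using step_le[OF xy(1,2)] xy(3) by simp
  ultimately show ?case by blast
next
  case (Suc n)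
  let ?E = "pseudometric_entourage (X (Suc n)) (d (Suc n)) (1 / 4 ^ Suc (Suc n))"
  have single: "\<exists>s. chain_cost X d Y u v s \<and> s < 1 / 4 ^ Suc (Suc n)" if "(u, v) \<in> ?E" for u v
  proof -
    have uv: "u \<in> X (Suc n)" "v \<in> X (Suc n)" "d (Suc n) u v < 1 / 4 ^ Suc (Suc n)"
      using that by (auto simp: pseudometric_entourage_def)
    then have "chain_cost X d Y u v (d (level2 X u v) u v)" by (intro chain_cost_single) auto
    moreover have "d (level2 X u v) u v < 1 / 4 ^ Suc (Suc n)"
      using step_le[OF uv(1,2)] uv(3) by (rule le_less_trans)
    ultimately show ?thesis by blast
  qed
  from Suc.prems obtain a b where ab: "(x, a) \<in> ?E" "(b, y) \<in> ?E"
    "a = b \<or> (a, b) \<in> valley X (\<lambda>n. pseudometric_entourage (X n) (d n) (1 / 4 ^ Suc n)) n"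
    by (rule valley_SucE)
  obtain r t where rt: "chain_cost X d Y x a r" "r < 1 / 4 ^ Suc (Suc n)"
    "chain_cost X d Y b y t" "t < 1 / 4 ^ Suc (Suc n)"
    using single ab by blast
  have u: "(1::real) / 4 ^ n \<le> 1 / 2 ^ n" "(1::real) / 2 ^ n \<le> 1" "0 < (1::real) / 2 ^ n"
    by (simp_all add: frac_le power_mono)
  have "\<exists>s. chain_cost X d Y a b s \<and> s < 1 - 1 / 2 ^ Suc n"
    using ab(3)
  proof
    assume "a = b"
    moreover have "a \<in> Y" using chain_cost_endpoints[OF rt(1)] by blast
    moreover have "(1::real) \<le> 2 ^ n" by simp
    then have "(1::real) < 2 * 2 ^ n" by linarith
    then have "(0::real) < 1 - 1 / 2 ^ Suc n" by simp
    ultimately show ?thesis using chain_cost.refl[of a Y X d] by blast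
  qed (rule Suc.IH)
  then obtain s where s: "chain_cost X d Y a b s" "s < 1 - 1 / 2 ^ Suc n" by blast
  have "chain_cost X d Y x y (r + s + t)"
    using chain_cost_trans[OF rt(3) chain_cost_trans[OF s(1) rt(1)]] .
  \<comment> \<open>In \<open>v\<close> and \<open>w\<close> the estimate is linear: the new steps
    cost less than \<open>v / 8\<close>, and the bound grows by \<open>w / 4\<close> with
    \<open>v \<le> w\<close>.\<close>
  moreover define v w :: real where "v = 1 / 4 ^ n" and "w = 1 / 2 ^ n"
  have "r < v / 16" "t < v / 16" "s < 1 - w / 2" "v \<le> w" "0 < w"
    using rt(2,4) s(2) u unfolding v_def w_def by simp_all
  then have "r + s + t < 1 - w / 4" by linarith
  then have "r + s + t < 1 - 1 / 2 ^ Suc (Suc n)" unfolding w_def by simp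
  ultimately show ?case by blast
qed

lemma lim_entourage_in_limit: "pseudometric_entourage Y (lim_pseudometric X d) 1 \<in> limit"
proof (rule uniformity_onD(4)[OF limit_uniformity])
  let ?E = "\<lambda>n. pseudometric_entourage (X n) (d n) (1 / 4 ^ Suc n)"
  have E: "?E n \<in> \<U> n" for n by (rule d_entourage) simp
  then show "(\<Union>n. valley X ?E n) \<in> limit" by (rule valley_in_limit)
  show "(\<Union>n. valley X ?E n) \<subseteq> pseudometric_entourage Y (lim_pseudometric X d) 1"
  proof (rule subrelI)
    fix x y assume "(x, y) \<in> (\<Union>n. valley X ?E n)"
    then obtain n where n: "(x, y) \<in> valley X ?E n" by blast
    obtain s where s: "chain_cost X d Y x y s" "s < 1 - 1 / 2 ^ Suc n"
      using valley_chain_cost[OF n] by blast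
    have "0 < (1::real) / 2 ^ Suc n" by simp
    then have "lim_pseudometric X d x y < 1" using lim_le[OF s(1)] s(2) by linarith
    then show "(x, y) \<in> pseudometric_entourage Y (lim_pseudometric X d) 1"
      using chain_cost_endpoints[OF s(1)] by (simp add: pseudometric_entourage_def)
  qed
qed (auto simp: pseudometric_entourage_def)

end

text \<open>A limit entourage contains the valleys of one sequence \<open>D\<close>, and adequacy
  provides a single member of \<open>\<A>\<close> whose unit entourages refine all
  \<open>D n\<close> simultaneously.\<close>

theorem (in uniform_tower) limit_generated_by_pseudometrics:
  assumes "adequate_family X \<U> \<A>"
  shows "uniformity_generated_by_pseudometrics (\<Union>n. X n) limit (lim_pseudometric X ` \<A>)"
proof -
  have tower: "monotone_pseudometric_tower X \<U> d" if "d \<in> \<A>" for d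
    using assms that uniform_tower_axioms
    by (auto simp: adequate_family_def monotone_pseudometric_tower_def
        monotone_pseudometric_tower_axioms_def)
  have "\<exists>d\<in>\<A>. pseudometric_entourage (\<Union>n. X n) (lim_pseudometric X d) 1 \<subseteq> E" if E: "E \<in> limit" for E
  proof -
    obtain D where D: "\<And>n. D n \<in> \<U> n" "\<And>n. valley X D n \<subseteq> E" using limit_valley[OF E] by blast
    then obtain d where d: "d \<in> \<A>" "\<And>n. pseudometric_entourage (X n) (d n) 1 \<subseteq> D n"
      using assms unfolding adequate_family_def by blast
    have "valley X (\<lambda>n. pseudometric_entourage (X n) (d n) 1) n \<subseteq> E" for n
      by (rule order_trans[OF valley_mono[where F = D] D(2)]) (rule d(2))
    then show ?thesis
      using monotone_pseudometric_tower.lim_entourage_subset_valley[OF tower[OF d(1)]] d(1) by blast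
  qed
  then show ?thesis
    unfolding uniformity_generated_by_pseudometrics_def uniformity_base_def
  proof (intro conjI ballI subsetI)
    fix d assume "d \<in> lim_pseudometric X ` \<A>"
    then show "pseudometric_on (\<Union>n. X n) d"
      using monotone_pseudometric_tower.lim_pseudometric[OF tower] by auto
  next
    fix B assume "B \<in> (\<lambda>d. pseudometric_entourage (\<Union>n. X n) d 1) ` lim_pseudometric X ` \<A>"
    then show "B \<in> limit"
      using monotone_pseudometric_tower.lim_entourage_in_limit[OF tower] by auto
  qed simp
qed

section \<open>Towers of topological groups\<close>

locale top_group =
  fixes K :: "'a monoid" and T :: "'a topology"
  assumes topological_group: "topological_group K T"
begin

sublocale group K
  using topological_group unfolding topological_group_def by simp

lemma topspace: "topspace T = carrier K"
  and continuous_mult: "continuous_map (prod_topology T T) T (\<lambda>(x, y). x \<otimes>\<^bsub>K\<^esub> y)"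
  and continuous_inv: "continuous_map T T (\<lambda>x. inv\<^bsub>K\<^esub> x)"
  using topological_group unfolding topological_group_def by simp_all

lemma nbhd_carrier: "openin T V \<Longrightarrow> V \<subseteq> carrier K"
  using openin_subset topspace by blast

lemma open_symmetric_nbhdsD:
  assumes "U \<in> open_symmetric_nbhds K T"
  shows "openin T U" "\<one>\<^bsub>K\<^esub> \<in> U" "U \<subseteq> carrier K" "u \<in> U \<Longrightarrow> inv\<^bsub>K\<^esub> u \<in> U"
proof -
  show "openin T U" "\<one>\<^bsub>K\<^esub> \<in> U" using assms unfolding open_symmetric_nbhds_def by auto
  then show "U \<subseteq> carrier K" using nbhd_carrier by blast
  have "set_inv\<^bsub>K\<^esub> U = U" using assms unfolding open_symmetric_nbhds_def by auto
  then show "u \<in> U \<Longrightarrow> inv\<^bsub>K\<^esub> u \<in> U" unfolding SET_INV_def by blast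
qed

lemma symmetric_nbhd:
  assumes V: "openin T V" "\<one>\<^bsub>K\<^esub> \<in> V"
  obtains U where "U \<in> open_symmetric_nbhds K T" "U \<subseteq> V"
proof -
  let ?U = "V \<inter> {x \<in> topspace T. inv\<^bsub>K\<^esub> x \<in> V}"
  have "openin T ?U"
    using V(1) openin_continuous_map_preimage[OF continuous_inv V(1)] by (rule openin_Int)
  moreover have "\<one>\<^bsub>K\<^esub> \<in> ?U" using V(2) topspace by simp
  moreover have "set_inv\<^bsub>K\<^esub> ?U = ?U"
  proof
    show "set_inv\<^bsub>K\<^esub> ?U \<subseteq> ?U" using topspace unfolding SET_INV_def by auto
    show "?U \<subseteq> set_inv\<^bsub>K\<^esub> ?U"
    proof
      fix x assume x: "x \<in> ?U"
      then have "inv\<^bsub>K\<^esub> x \<in> ?U" "x = inv\<^bsub>K\<^esub> (inv\<^bsub>K\<^esub> x)" using topspace by auto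
      then show "x \<in> set_inv\<^bsub>K\<^esub> ?U" unfolding SET_INV_def by blast
    qed
  qed
  ultimately have "?U \<in> open_symmetric_nbhds K T" unfolding open_symmetric_nbhds_def by simp
  with that show thesis by blast
qed

lemma symmetric_nbhd_square:
  assumes V: "openin T V" "\<one>\<^bsub>K\<^esub> \<in> V"
  obtains U where "U \<in> open_symmetric_nbhds K T"
    "\<And>u v. u \<in> U \<Longrightarrow> v \<in> U \<Longrightarrow> u \<otimes>\<^bsub>K\<^esub> v \<in> V"
proof -
  define P where "P = {p \<in> topspace (prod_topology T T). (\<lambda>(x, y). x \<otimes>\<^bsub>K\<^esub> y) p \<in> V}"
  have "openin (prod_topology T T) P"
    unfolding P_def by (rule openin_continuous_map_preimage[OF continuous_mult V(1)])
  moreover have "(\<one>\<^bsub>K\<^esub>, \<one>\<^bsub>K\<^esub>) \<in> P" unfolding P_def using V(2) topspace by simp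
  ultimately have "\<exists>A B. openin T A \<and> openin T B \<and> \<one>\<^bsub>K\<^esub> \<in> A \<and> \<one>\<^bsub>K\<^esub> \<in> B \<and> A \<times> B \<subseteq> P"
    by (simp only: openin_prod_topology_alt)
  then obtain A B where AB: "openin T A" "openin T B" "\<one>\<^bsub>K\<^esub> \<in> A" "\<one>\<^bsub>K\<^esub> \<in> B" "A \<times> B \<subseteq> P"
    by blast
  obtain U where U: "U \<in> open_symmetric_nbhds K T" "U \<subseteq> A \<inter> B"
    using symmetric_nbhd[of "A \<inter> B"] AB by blast
  have "u \<otimes>\<^bsub>K\<^esub> v \<in> V" if "u \<in> U" "v \<in> U" for u v
  proof -
    have "(u, v) \<in> P" using that U(2) AB(5) by blast
    then show ?thesis unfolding P_def by simp
  qed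
  with U(1) that show thesis by blast
qed

lemma continuous_translations:
  assumes "a \<in> carrier K" "b \<in> carrier K"
  shows "continuous_map T T (\<lambda>x. a \<otimes>\<^bsub>K\<^esub> x \<otimes>\<^bsub>K\<^esub> b)"
proof -
  have const: "continuous_map T T (\<lambda>_. c)" if "c \<in> carrier K" for c
    using that topspace by simp
  have mult: "continuous_map T T (\<lambda>x. f x \<otimes>\<^bsub>K\<^esub> g x)"
    if "continuous_map T T f" "continuous_map T T g" for f g
  proof -
    have "continuous_map T (prod_topology T T) (\<lambda>x. (f x, g x))"
      using that by (simp add: continuous_map_pairedI)
    from continuous_map_compose[OF this continuous_mult] show ?thesis by (simp add: o_def)
  qed
  show ?thesis by (intro mult const assms continuous_map_id[unfolded id_def])
qed

text \<open>Conjugation by a fixed element is the bridge between steps of the left uniformity, which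
  multiply on the right, and the right translates in \<open>tau_right\<close>.\<close>

lemma symmetric_nbhd_conj:
  assumes V: "openin T V" "\<one>\<^bsub>K\<^esub> \<in> V" and x: "x \<in> carrier K"
  obtains U where "U \<in> open_symmetric_nbhds K T"
    "\<And>u. u \<in> U \<Longrightarrow> x \<otimes>\<^bsub>K\<^esub> u \<otimes>\<^bsub>K\<^esub> inv\<^bsub>K\<^esub> x \<in> V"
proof -
  let ?W = "{u \<in> topspace T. x \<otimes>\<^bsub>K\<^esub> u \<otimes>\<^bsub>K\<^esub> inv\<^bsub>K\<^esub> x \<in> V}"
  have "openin T ?W"
    by (rule openin_continuous_map_preimage[OF continuous_translations V(1)]) (simp_all add: x)
  moreover have "\<one>\<^bsub>K\<^esub> \<in> ?W" using V(2) topspace x by simp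
  ultimately obtain U where "U \<in> open_symmetric_nbhds K T" "U \<subseteq> ?W" by (rule symmetric_nbhd)
  with that show thesis by blast
qed

lemma inv_cancel:
  assumes "a \<in> carrier K" "b \<in> carrier K"
  shows "a \<otimes>\<^bsub>K\<^esub> (inv\<^bsub>K\<^esub> a \<otimes>\<^bsub>K\<^esub> b) = b" "inv\<^bsub>K\<^esub> a \<otimes>\<^bsub>K\<^esub> (a \<otimes>\<^bsub>K\<^esub> b) = b"
  using assms by (simp_all add: m_assoc[symmetric])

lemma left_entourage_iff:
  assumes U: "U \<subseteq> carrier K" and xy: "x \<in> carrier K" "y \<in> carrier K"
  shows "x \<in> y <#\<^bsub>K\<^esub> U \<longleftrightarrow> inv\<^bsub>K\<^esub> y \<otimes>\<^bsub>K\<^esub> x \<in> U"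
proof
  assume "x \<in> y <#\<^bsub>K\<^esub> U"
  then obtain u where u: "u \<in> U" "x = y \<otimes>\<^bsub>K\<^esub> u" unfolding l_coset_def by blast
  moreover have "u \<in> carrier K" using u U by blast
  ultimately show "inv\<^bsub>K\<^esub> y \<otimes>\<^bsub>K\<^esub> x \<in> U" using xy by (simp add: m_assoc[symmetric])
next
  assume u: "inv\<^bsub>K\<^esub> y \<otimes>\<^bsub>K\<^esub> x \<in> U"
  have "x = y \<otimes>\<^bsub>K\<^esub> (inv\<^bsub>K\<^esub> y \<otimes>\<^bsub>K\<^esub> x)" using xy by (simp add: inv_cancel)
  with u show "x \<in> y <#\<^bsub>K\<^esub> U" unfolding l_coset_def by blast
qed

lemma left_uniformity_iff:
  "E \<in> left_uniformity K T \<longleftrightarrow> E \<subseteq> carrier K \<times> carrier K \<and>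
     (\<exists>U\<in>open_symmetric_nbhds K T. \<forall>x\<in>carrier K. \<forall>y\<in>carrier K. inv\<^bsub>K\<^esub> y \<otimes>\<^bsub>K\<^esub> x \<in> U \<longrightarrow> (x, y) \<in> E)"
proof -
  have "{(x, y) \<in> carrier K \<times> carrier K. x \<in> y <#\<^bsub>K\<^esub> U} \<subseteq> E \<longleftrightarrow>
      (\<forall>x\<in>carrier K. \<forall>y\<in>carrier K. inv\<^bsub>K\<^esub> y \<otimes>\<^bsub>K\<^esub> x \<in> U \<longrightarrow> (x, y) \<in> E)"
    if "U \<in> open_symmetric_nbhds K T" for U
    using left_entourage_iff[OF open_symmetric_nbhdsD(3)[OF that]] by auto
  then show ?thesis unfolding left_uniformity_def by auto
qed

lemma left_uniformityI:
  assumes "E \<subseteq> carrier K \<times> carrier K" "openin T V" "\<one>\<^bsub>K\<^esub> \<in> V"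
    and "\<And>x y. x \<in> carrier K \<Longrightarrow> y \<in> carrier K \<Longrightarrow> inv\<^bsub>K\<^esub> y \<otimes>\<^bsub>K\<^esub> x \<in> V \<Longrightarrow> (x, y) \<in> E"
  shows "E \<in> left_uniformity K T"
  using symmetric_nbhd[OF assms(2,3)] assms(1,4) unfolding left_uniformity_iff by (metis subsetD)

lemma left_uniformityE:
  assumes "E \<in> left_uniformity K T"
  obtains U where "U \<in> open_symmetric_nbhds K T"
    "\<And>x y. x \<in> carrier K \<Longrightarrow> y \<in> carrier K \<Longrightarrow> inv\<^bsub>K\<^esub> y \<otimes>\<^bsub>K\<^esub> x \<in> U \<Longrightarrow> (x, y) \<in> E"
  using assms unfolding left_uniformity_iff by blast

lemma uniformity_on_left_uniformity: "uniformity_on (carrier K) (left_uniformity K T)"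
  unfolding uniformity_on_def
proof (intro conjI ballI allI impI)
  show "carrier K \<times> carrier K \<in> left_uniformity K T"
    using openin_topspace[of T] unfolding topspace by (rule left_uniformityI[OF order_refl]) auto
next
  fix E assume "E \<in> left_uniformity K T"
  then show "E \<subseteq> carrier K \<times> carrier K" unfolding left_uniformity_iff by blast
next
  fix E assume "E \<in> left_uniformity K T"
  then obtain U where U: "U \<in> open_symmetric_nbhds K T"
    "\<And>x y. x \<in> carrier K \<Longrightarrow> y \<in> carrier K \<Longrightarrow> inv\<^bsub>K\<^esub> y \<otimes>\<^bsub>K\<^esub> x \<in> U \<Longrightarrow> (x, y) \<in> E"
    by (rule left_uniformityE) blast
  show "Id_on (carrier K) \<subseteq> E"
  proof
    fix p assume "p \<in> Id_on (carrier K)"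
    then obtain x where x: "p = (x, x)" "x \<in> carrier K" by blast
    then show "p \<in> E" using U(2)[of x x] open_symmetric_nbhdsD(2)[OF U(1)] by simp
  qed
next
  fix E F assume "E \<in> left_uniformity K T" "E \<subseteq> F \<and> F \<subseteq> carrier K \<times> carrier K"
  then show "F \<in> left_uniformity K T" unfolding left_uniformity_iff by (meson subsetD)
next
  fix E F assume EF: "E \<in> left_uniformity K T" "F \<in> left_uniformity K T"
  obtain U where U: "U \<in> open_symmetric_nbhds K T"
    "\<And>x y. x \<in> carrier K \<Longrightarrow> y \<in> carrier K \<Longrightarrow> inv\<^bsub>K\<^esub> y \<otimes>\<^bsub>K\<^esub> x \<in> U \<Longrightarrow> (x, y) \<in> E"
    using EF(1) by (rule left_uniformityE) blast
  obtain V where V: "V \<in> open_symmetric_nbhds K T"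
    "\<And>x y. x \<in> carrier K \<Longrightarrow> y \<in> carrier K \<Longrightarrow> inv\<^bsub>K\<^esub> y \<otimes>\<^bsub>K\<^esub> x \<in> V \<Longrightarrow> (x, y) \<in> F"
    using EF(2) by (rule left_uniformityE) blast
  have "E \<inter> F \<subseteq> carrier K \<times> carrier K" using EF(1) unfolding left_uniformity_iff by blast
  moreover have "openin T (U \<inter> V)" "\<one>\<^bsub>K\<^esub> \<in> U \<inter> V"
    using open_symmetric_nbhdsD(1,2)[OF U(1)] open_symmetric_nbhdsD(1,2)[OF V(1)] by auto
  ultimately show "E \<inter> F \<in> left_uniformity K T"
    by (rule left_uniformityI) (use U(2) V(2) in blast)
next
  fix E assume E: "E \<in> left_uniformity K T"
  then obtain U where U: "U \<in> open_symmetric_nbhds K T"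
    "\<And>x y. x \<in> carrier K \<Longrightarrow> y \<in> carrier K \<Longrightarrow> inv\<^bsub>K\<^esub> y \<otimes>\<^bsub>K\<^esub> x \<in> U \<Longrightarrow> (x, y) \<in> E"
    by (rule left_uniformityE) blast
  have "E\<inverse> \<subseteq> carrier K \<times> carrier K" using E unfolding left_uniformity_iff by blast
  then show "E\<inverse> \<in> left_uniformity K T"
  proof (rule left_uniformityI)
    show "openin T U" "\<one>\<^bsub>K\<^esub> \<in> U" using open_symmetric_nbhdsD(1,2)[OF U(1)] by auto
    fix x y assume xy: "x \<in> carrier K" "y \<in> carrier K" "inv\<^bsub>K\<^esub> y \<otimes>\<^bsub>K\<^esub> x \<in> U"
    then have "inv\<^bsub>K\<^esub> (inv\<^bsub>K\<^esub> y \<otimes>\<^bsub>K\<^esub> x) \<in> U" using open_symmetric_nbhdsD(4)[OF U(1)] by blast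
    then have "inv\<^bsub>K\<^esub> x \<otimes>\<^bsub>K\<^esub> y \<in> U" using xy by (simp add: inv_mult_group)
    then show "(x, y) \<in> E\<inverse>" using U(2) xy by blast
  qed
next
  fix E assume E: "E \<in> left_uniformity K T"
  then obtain U where U: "U \<in> open_symmetric_nbhds K T"
    "\<And>x y. x \<in> carrier K \<Longrightarrow> y \<in> carrier K \<Longrightarrow> inv\<^bsub>K\<^esub> y \<otimes>\<^bsub>K\<^esub> x \<in> U \<Longrightarrow> (x, y) \<in> E"
    by (rule left_uniformityE) blast
  obtain V where V: "V \<in> open_symmetric_nbhds K T"
    "\<And>u v. u \<in> V \<Longrightarrow> v \<in> V \<Longrightarrow> u \<otimes>\<^bsub>K\<^esub> v \<in> U"
    using symmetric_nbhd_square[OF open_symmetric_nbhdsD(1,2)[OF U(1)]] by blast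
  let ?F = "{(x, y) \<in> carrier K \<times> carrier K. inv\<^bsub>K\<^esub> y \<otimes>\<^bsub>K\<^esub> x \<in> V}"
  have "?F \<in> left_uniformity K T"
    by (rule left_uniformityI[OF _ open_symmetric_nbhdsD(1,2)[OF V(1)]]) auto
  moreover have "?F O ?F \<subseteq> E"
  proof
    fix p assume "p \<in> ?F O ?F"
    then obtain x y z where p: "p = (x, z)" "x \<in> carrier K" "y \<in> carrier K" "z \<in> carrier K"
      "inv\<^bsub>K\<^esub> y \<otimes>\<^bsub>K\<^esub> x \<in> V" "inv\<^bsub>K\<^esub> z \<otimes>\<^bsub>K\<^esub> y \<in> V"
      by blast
    have "inv\<^bsub>K\<^esub> z \<otimes>\<^bsub>K\<^esub> y \<otimes>\<^bsub>K\<^esub> (inv\<^bsub>K\<^esub> y \<otimes>\<^bsub>K\<^esub> x) = inv\<^bsub>K\<^esub> z \<otimes>\<^bsub>K\<^esub> (y \<otimes>\<^bsub>K\<^esub> inv\<^bsub>K\<^esub> y) \<otimes>\<^bsub>K\<^esub> x"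
      using p(2-4) by (simp only: m_assoc m_closed inv_closed)
    also have "\<dots> = inv\<^bsub>K\<^esub> z \<otimes>\<^bsub>K\<^esub> x" using p(2-4) by simp
    finally have "inv\<^bsub>K\<^esub> z \<otimes>\<^bsub>K\<^esub> x \<in> U" using V(2)[OF p(6,5)] by simp
    then show "p \<in> E" using U(2) p by blast
  qed
  ultimately show "\<exists>F\<in>left_uniformity K T. F O F \<subseteq> E" by blast
qed

end

section \<open>The union group and the tower of left uniformities\<close>

locale group_tower =
  fixes G :: "nat \<Rightarrow> 'a monoid" and T :: "nat \<Rightarrow> 'a topology"
  assumes tower: "tower_of_topological_groups G T"
begin

abbreviation "C \<equiv> \<lambda>n. carrier (G n)"
abbreviation "H \<equiv> union_group G"
abbreviation "\<L> \<equiv> \<lambda>n. left_uniformity (G n) (T n)"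

sublocale stage: top_group "G n" "T n" for n
  using tower unfolding tower_of_topological_groups_def top_group_def by blast

lemma carrier_Suc: "C n \<subseteq> C (Suc n)"
  and T_Suc: "T n = subtopology (T (Suc n)) (C n)"
  using tower unfolding tower_of_topological_groups_def by blast+

lemma carrier_mono: "n \<le> m \<Longrightarrow> C n \<subseteq> C m"
  using lift_Suc_mono_le[of C] carrier_Suc by blast

lemma carrier_union: "carrier H = (\<Union>n. C n)"
  unfolding union_group_def by simp

lemma carrier_unionI: "x \<in> C n \<Longrightarrow> x \<in> carrier H"
  unfolding carrier_union by blast

lemma mult_stage:
  assumes "n \<le> m" "x \<in> C n" "y \<in> C n"
  shows "x \<otimes>\<^bsub>G n\<^esub> y = x \<otimes>\<^bsub>G m\<^esub> y"
  using assms(1)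
proof (induction rule: dec_induct)
  case (step k)
  have "x \<in> C k" "y \<in> C k" using carrier_mono[OF step(1)] assms by auto
  then have "x \<otimes>\<^bsub>G k\<^esub> y = x \<otimes>\<^bsub>G (Suc k)\<^esub> y"
    using tower unfolding tower_of_topological_groups_def by blast
  then show ?case using step.IH by simp
qed simp

lemma mult_union:
  assumes "x \<in> C n" "y \<in> C n"
  shows "x \<otimes>\<^bsub>H\<^esub> y = x \<otimes>\<^bsub>G n\<^esub> y"
proof -
  let ?l = "level2 C x y"
  have l: "level C z \<le> n" "z \<in> C (level C z)" if "z \<in> C n" for z
    unfolding level_def using that by (auto intro: Least_le LeastI)
  have "?l \<le> n" unfolding level2_def using l assms by simp
  moreover have "x \<in> C ?l" "y \<in> C ?l"
    using l(2)[OF assms(1)] l(2)[OF assms(2)] carrier_mono[of "level C x" ?l]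
      carrier_mono[of "level C y" ?l]
    unfolding level2_def by auto
  ultimately have "x \<otimes>\<^bsub>G ?l\<^esub> y = x \<otimes>\<^bsub>G n\<^esub> y" by (rule mult_stage)
  then show ?thesis unfolding union_group_def by simp
qed

lemma one_union: "\<one>\<^bsub>H\<^esub> = \<one>\<^bsub>G n\<^esub>"
proof -
  have "\<one>\<^bsub>G 0\<^esub> \<in> C n" using carrier_mono[of 0 n] by auto
  \<comment> \<open>An idempotent of the group \<open>G n\<close> is its neutral element.\<close>
  moreover have "\<one>\<^bsub>G 0\<^esub> \<otimes>\<^bsub>G n\<^esub> \<one>\<^bsub>G 0\<^esub> = \<one>\<^bsub>G 0\<^esub>" using mult_stage[of 0 n "\<one>\<^bsub>G 0\<^esub>" "\<one>\<^bsub>G 0\<^esub>"] by simp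
  ultimately have "\<one>\<^bsub>G 0\<^esub> = \<one>\<^bsub>G n\<^esub>" by simp
  then show ?thesis unfolding union_group_def by simp
qed

lemma common_stage:
  assumes "x \<in> carrier H" "y \<in> carrier H"
  obtains n where "x \<in> C n" "y \<in> C n"
proof -
  obtain i j where "x \<in> C i" "y \<in> C j" using assms unfolding carrier_union by blast
  then have "x \<in> C (max i j)" "y \<in> C (max i j)"
    using carrier_mono[of i "max i j"] carrier_mono[of j "max i j"] by auto
  with that show thesis by blast
qed

lemma union_closed: "x \<in> C n \<Longrightarrow> y \<in> C n \<Longrightarrow> x \<otimes>\<^bsub>H\<^esub> y \<in> C n"
  by (simp add: mult_union)

sublocale union: group H
proof (rule groupI)
  show "x \<otimes>\<^bsub>H\<^esub> y \<in> carrier H" if "x \<in> carrier H" "y \<in> carrier H" for x y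
  proof -
    obtain n where "x \<in> C n" "y \<in> C n" using \<open>x \<in> carrier H\<close> \<open>y \<in> carrier H\<close> by (rule common_stage)
    then show ?thesis by (intro carrier_unionI[OF union_closed])
  qed
  show "\<one>\<^bsub>H\<^esub> \<in> carrier H" using one_union[of 0] carrier_unionI[of _ 0] by simp
  show "x \<otimes>\<^bsub>H\<^esub> y \<otimes>\<^bsub>H\<^esub> z = x \<otimes>\<^bsub>H\<^esub> (y \<otimes>\<^bsub>H\<^esub> z)"
    if "x \<in> carrier H" "y \<in> carrier H" "z \<in> carrier H" for x y z
  proof -
    obtain n where n: "x \<in> C n" "y \<in> C n" using \<open>x \<in> carrier H\<close> \<open>y \<in> carrier H\<close> by (rule common_stage)
    obtain m where "z \<in> C m" using \<open>z \<in> carrier H\<close> unfolding carrier_union by blast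
    then have "x \<in> C (max n m)" "y \<in> C (max n m)" "z \<in> C (max n m)"
      using n carrier_mono[of n "max n m"] carrier_mono[of m "max n m"] by auto
    then show ?thesis by (simp add: mult_union[of _ "max n m"] stage.m_assoc)
  qed
  show "\<one>\<^bsub>H\<^esub> \<otimes>\<^bsub>H\<^esub> x = x" if "x \<in> carrier H" for x
  proof -
    obtain n where "x \<in> C n" using \<open>x \<in> carrier H\<close> unfolding carrier_union by blast
    then show ?thesis by (simp add: mult_union[of _ n] one_union[of n])
  qed
  show "\<exists>y\<in>carrier H. y \<otimes>\<^bsub>H\<^esub> x = \<one>\<^bsub>H\<^esub>" if "x \<in> carrier H" for x
  proof -
    obtain n where "x \<in> C n" using \<open>x \<in> carrier H\<close> unfolding carrier_union by blast
    then show ?thesis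
      by (intro bexI[of _ "inv\<^bsub>G n\<^esub> x"]) (auto simp: mult_union[of _ n] one_union[of n] intro: carrier_unionI)
  qed
qed

lemma inv_union:
  assumes "x \<in> C n"
  shows "inv\<^bsub>H\<^esub> x = inv\<^bsub>G n\<^esub> x"
  by (rule union.inv_equality)
    (use assms in \<open>auto simp: mult_union[of _ n] one_union[of n] intro: carrier_unionI\<close>)

lemma openin_restrict:
  assumes "n \<le> m" "openin (T m) V"
  shows "openin (T n) (V \<inter> C n)"
  using assms
proof (induction rule: inc_induct)
  case base
  then show ?case using stage.nbhd_carrier by (simp add: Int_absorb2)
next
  case (step k)
  have "openin (T k) (V \<inter> C (Suc k) \<inter> C k)" using step T_Suc[of k] by (metis openin_subtopology_Int)
  moreover have "V \<inter> C (Suc k) \<inter> C k = V \<inter> C k" using carrier_Suc by blast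
  ultimately show ?case by simp
qed

text \<open>The quotient of two elements, computed in \<open>H\<close>, is the same at both stages.
  Hence the subspace topology yields the subspace uniformity: traces of open sets are open, and
  every open set of \<open>G n\<close> is the trace of an open set of the next group.\<close>

sublocale uniform_tower C \<L>
proof
  show "uniformity_on (C n) (\<L> n)" for n by (rule stage.uniformity_on_left_uniformity)
  show "C n \<subseteq> C (Suc n)" for n by (rule carrier_Suc)
  show "E \<inter> C n \<times> C n \<in> \<L> n" if E: "E \<in> \<L> (Suc n)" for E n
  proof -
    obtain U where U: "U \<in> open_symmetric_nbhds (G (Suc n)) (T (Suc n))"
      "\<And>x y. x \<in> C (Suc n) \<Longrightarrow> y \<in> C (Suc n) \<Longrightarrow>
        inv\<^bsub>G (Suc n)\<^esub> y \<otimes>\<^bsub>G (Suc n)\<^esub> x \<in> U \<Longrightarrow> (x, y) \<in> E"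
      using E by (rule stage.left_uniformityE) blast
    show ?thesis
    proof (rule stage.left_uniformityI)
      show "openin (T n) (U \<inter> C n)"
        using stage.open_symmetric_nbhdsD(1)[OF U(1)] by (intro openin_restrict[of n "Suc n"]) auto
      show "\<one>\<^bsub>G n\<^esub> \<in> U \<inter> C n"
        using stage.open_symmetric_nbhdsD(2)[OF U(1)] one_union[of n] one_union[of "Suc n"] by simp
      fix x y assume xy: "x \<in> C n" "y \<in> C n" "inv\<^bsub>G n\<^esub> y \<otimes>\<^bsub>G n\<^esub> x \<in> U \<inter> C n"
      have xy': "x \<in> C (Suc n)" "y \<in> C (Suc n)" using xy carrier_Suc by blast+
      have "inv\<^bsub>G n\<^esub> y \<otimes>\<^bsub>G n\<^esub> x = inv\<^bsub>H\<^esub> y \<otimes>\<^bsub>H\<^esub> x"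
        using xy by (simp add: inv_union[of _ n] mult_union[of _ n])
      also have "\<dots> = inv\<^bsub>G (Suc n)\<^esub> y \<otimes>\<^bsub>G (Suc n)\<^esub> x"
        using xy' by (simp add: inv_union[of _ "Suc n"] mult_union[of _ "Suc n"])
      finally show "(x, y) \<in> E \<inter> C n \<times> C n" using U(2)[OF xy'] xy by simp
    qed simp
  qed
  show "\<exists>F\<in>\<L> (Suc n). F \<inter> C n \<times> C n \<subseteq> E" if E: "E \<in> \<L> n" for E n
  proof -
    obtain U where U: "U \<in> open_symmetric_nbhds (G n) (T n)"
      "\<And>x y. x \<in> C n \<Longrightarrow> y \<in> C n \<Longrightarrow> inv\<^bsub>G n\<^esub> y \<otimes>\<^bsub>G n\<^esub> x \<in> U \<Longrightarrow> (x, y) \<in> E"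
      using E by (rule stage.left_uniformityE) blast
    have "openin (subtopology (T (Suc n)) (C n)) U"
      using stage.open_symmetric_nbhdsD(1)[OF U(1)] T_Suc[of n] by simp
    then obtain V where V: "openin (T (Suc n)) V" "U = V \<inter> C n" unfolding openin_subtopology by blast
    let ?F = "{(x, y) \<in> C (Suc n) \<times> C (Suc n). inv\<^bsub>G (Suc n)\<^esub> y \<otimes>\<^bsub>G (Suc n)\<^esub> x \<in> V}"
    have "\<one>\<^bsub>G (Suc n)\<^esub> \<in> V"
      using stage.open_symmetric_nbhdsD(2)[OF U(1)] V(2) one_union[of n] one_union[of "Suc n"] by simp
    then have "?F \<in> \<L> (Suc n)" by (intro stage.left_uniformityI[OF _ V(1)]) auto
    moreover have "?F \<inter> C n \<times> C n \<subseteq> E"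
    proof (rule subrelI)
      fix x y assume F: "(x, y) \<in> ?F \<inter> C n \<times> C n"
      then have xy: "x \<in> C n" "y \<in> C n" "x \<in> C (Suc n)" "y \<in> C (Suc n)"
        "inv\<^bsub>G (Suc n)\<^esub> y \<otimes>\<^bsub>G (Suc n)\<^esub> x \<in> V" by auto
      have "inv\<^bsub>G n\<^esub> y \<otimes>\<^bsub>G n\<^esub> x = inv\<^bsub>H\<^esub> y \<otimes>\<^bsub>H\<^esub> x"
        using xy by (simp add: inv_union[of _ n] mult_union[of _ n])
      also have "\<dots> = inv\<^bsub>G (Suc n)\<^esub> y \<otimes>\<^bsub>G (Suc n)\<^esub> x"
        using xy by (simp add: inv_union[of _ "Suc n"] mult_union[of _ "Suc n"])
      finally have "inv\<^bsub>G n\<^esub> y \<otimes>\<^bsub>G n\<^esub> x \<in> V" using xy(5) by simp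
      then have "inv\<^bsub>G n\<^esub> y \<otimes>\<^bsub>G n\<^esub> x \<in> U" unfolding V(2) using xy(1,2) by simp
      then show "(x, y) \<in> E" using U(2) xy by blast
    qed
    ultimately show ?thesis by blast
  qed
qed

text \<open>Any step from \<open>b\<close> to \<open>z\<close> multiplies by \<open>inv b z\<close>,
  and \<open>u\<close> is the conjugate of this factor by \<open>x\<close>. Starting from
  \<open>b = q x\<close>, the step thus inserts \<open>u\<close> between \<open>q\<close> and
  \<open>x\<close>.\<close>

lemma conj_entourage:
  assumes x: "x \<in> C k" and U: "U \<in> open_symmetric_nbhds (G k) (T k)"
  obtains D where "D \<in> \<L> k"
    "\<And>b z. (b, z) \<in> D \<Longrightarrow> \<exists>u\<in>U. z = b \<otimes>\<^bsub>H\<^esub> inv\<^bsub>H\<^esub> x \<otimes>\<^bsub>H\<^esub> u \<otimes>\<^bsub>H\<^esub> x"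
proof -
  obtain V where V: "V \<in> open_symmetric_nbhds (G k) (T k)"
    "\<And>v. v \<in> V \<Longrightarrow> x \<otimes>\<^bsub>G k\<^esub> v \<otimes>\<^bsub>G k\<^esub> inv\<^bsub>G k\<^esub> x \<in> U"
    using stage.symmetric_nbhd_conj[OF stage.open_symmetric_nbhdsD(1,2)[OF U] x] by blast
  let ?D = "{(b, z) \<in> C k \<times> C k. inv\<^bsub>G k\<^esub> z \<otimes>\<^bsub>G k\<^esub> b \<in> V}"
  have "?D \<in> \<L> k"
    by (rule stage.left_uniformityI[OF _ stage.open_symmetric_nbhdsD(1,2)[OF V(1)]]) auto
  moreover have "\<exists>u\<in>U. z = b \<otimes>\<^bsub>H\<^esub> inv\<^bsub>H\<^esub> x \<otimes>\<^bsub>H\<^esub> u \<otimes>\<^bsub>H\<^esub> x" if "(b, z) \<in> ?D" for b z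
  proof -
    have bz: "b \<in> C k" "z \<in> C k" "inv\<^bsub>G k\<^esub> z \<otimes>\<^bsub>G k\<^esub> b \<in> V" using that by auto
    \<comment> \<open>The entourage controls \<open>inv z b\<close>; symmetry of \<open>V\<close>
      gives control of \<open>inv b z\<close>.\<close>
    then have "inv\<^bsub>G k\<^esub> (inv\<^bsub>G k\<^esub> z \<otimes>\<^bsub>G k\<^esub> b) \<in> V" using stage.open_symmetric_nbhdsD(4)[OF V(1)] by blast
    then have v: "inv\<^bsub>G k\<^esub> b \<otimes>\<^bsub>G k\<^esub> z \<in> V" using bz by (simp add: stage.inv_mult_group)
    let ?u = "x \<otimes>\<^bsub>G k\<^esub> (inv\<^bsub>G k\<^esub> b \<otimes>\<^bsub>G k\<^esub> z) \<otimes>\<^bsub>G k\<^esub> inv\<^bsub>G k\<^esub> x"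
    have "z = b \<otimes>\<^bsub>G k\<^esub> inv\<^bsub>G k\<^esub> x \<otimes>\<^bsub>G k\<^esub> ?u \<otimes>\<^bsub>G k\<^esub> x"
      using bz(1,2) x by (simp add: stage.m_assoc stage.inv_cancel)
    also have "\<dots> = b \<otimes>\<^bsub>H\<^esub> inv\<^bsub>H\<^esub> x \<otimes>\<^bsub>H\<^esub> ?u \<otimes>\<^bsub>H\<^esub> x"
      using bz(1,2) x by (simp add: mult_union[of _ k] inv_union[of _ k])
    finally show ?thesis using V(2)[OF v] by blast
  qed
  ultimately show thesis by (rule that)
qed

text \<open>Two stages occur because \<open>y\<close> may appear later than stage \<open>i\<close>.
  The conjugation takes place in \<open>G N\<close>, and the base of \<open>G i\<close> refines the
  trace on \<open>G i\<close> of the resulting neighbourhood.\<close>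

lemma conj_nbhd:
  assumes y: "y \<in> C N" and D: "D \<in> \<L> N" and i: "i \<le> N" and B: "symmetric_nbhd_base (G i) (T i) B"
  obtains U where "U \<in> B"
    "\<And>b u. b \<in> C N \<Longrightarrow> u \<in> U \<Longrightarrow> (b, b \<otimes>\<^bsub>H\<^esub> inv\<^bsub>H\<^esub> y \<otimes>\<^bsub>H\<^esub> u \<otimes>\<^bsub>H\<^esub> y) \<in> D"
proof -
  obtain V where V: "V \<in> open_symmetric_nbhds (G N) (T N)"
    "\<And>x y. x \<in> C N \<Longrightarrow> y \<in> C N \<Longrightarrow> inv\<^bsub>G N\<^esub> y \<otimes>\<^bsub>G N\<^esub> x \<in> V \<Longrightarrow> (x, y) \<in> D"
    using D by (rule stage.left_uniformityE) blast
  have y': "inv\<^bsub>G N\<^esub> y \<in> C N" using y by simp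
  obtain W where W: "W \<in> open_symmetric_nbhds (G N) (T N)"
    "\<And>u. u \<in> W \<Longrightarrow> inv\<^bsub>G N\<^esub> y \<otimes>\<^bsub>G N\<^esub> u \<otimes>\<^bsub>G N\<^esub> inv\<^bsub>G N\<^esub> (inv\<^bsub>G N\<^esub> y) \<in> V"
    using stage.symmetric_nbhd_conj[OF stage.open_symmetric_nbhdsD(1,2)[OF V(1)] y'] by blast
  have "openin (T i) (W \<inter> C i)"
    using i stage.open_symmetric_nbhdsD(1)[OF W(1)] by (rule openin_restrict)
  moreover have "\<one>\<^bsub>G i\<^esub> \<in> W \<inter> C i"
    using stage.open_symmetric_nbhdsD(2)[OF W(1)] one_union[of i] one_union[of N] by simp
  ultimately obtain U where U: "U \<in> B" "U \<subseteq> W \<inter> C i" using B unfolding symmetric_nbhd_base_def by blast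
  have "(b, b \<otimes>\<^bsub>H\<^esub> inv\<^bsub>H\<^esub> y \<otimes>\<^bsub>H\<^esub> u \<otimes>\<^bsub>H\<^esub> y) \<in> D" if b: "b \<in> C N" and u: "u \<in> U" for b u
  proof -
    have uN: "u \<in> C N" using u U(2) carrier_mono[OF i] by blast
    let ?v = "inv\<^bsub>G N\<^esub> y \<otimes>\<^bsub>G N\<^esub> u \<otimes>\<^bsub>G N\<^esub> y"
    have "?v \<in> V" using W(2)[of u] u U(2) y by auto
    then have "inv\<^bsub>G N\<^esub> ?v \<in> V" using stage.open_symmetric_nbhdsD(4)[OF V(1)] by blast
    moreover have "inv\<^bsub>G N\<^esub> (b \<otimes>\<^bsub>G N\<^esub> ?v) \<otimes>\<^bsub>G N\<^esub> b = inv\<^bsub>G N\<^esub> ?v"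
      using b uN y by (simp add: stage.inv_mult_group stage.m_assoc)
    ultimately have "(b, b \<otimes>\<^bsub>G N\<^esub> ?v) \<in> D" using V(2)[of b "b \<otimes>\<^bsub>G N\<^esub> ?v"] b uN y by simp
    moreover have "b \<otimes>\<^bsub>G N\<^esub> ?v = b \<otimes>\<^bsub>H\<^esub> inv\<^bsub>H\<^esub> y \<otimes>\<^bsub>H\<^esub> u \<otimes>\<^bsub>H\<^esub> y"
      using b uN y by (simp add: mult_union[of _ N] inv_union[of _ N] stage.m_assoc)
    ultimately show ?thesis by simp
  qed
  with U(1) that show thesis by blast
qed

section \<open>Directed products and neighbourhoods of the limit\<close>

lemma initial_product_carrier:
  assumes "\<And>n. U n \<subseteq> C n"
  shows "initial_product H U n \<subseteq> C n"
proof (induction n)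
  case (Suc n)
  have "U (Suc n) \<subseteq> C (Suc n)" "initial_product H U n \<subseteq> C (Suc n)"
    using assms Suc carrier_Suc by blast+
  then show ?case unfolding initial_product.simps set_mult_def by (auto intro: union_closed)
qed (simp add: assms)

lemma initial_product_mono:
  assumes "\<And>n. U n \<subseteq> C n" "\<And>n. \<one>\<^bsub>H\<^esub> \<in> U n" "n \<le> m"
  shows "initial_product H U n \<subseteq> initial_product H U m"
proof -
  have "initial_product H U k \<subseteq> initial_product H U (Suc k)" for k
  proof
    fix p assume p: "p \<in> initial_product H U k"
    then have "p \<in> carrier H" using initial_product_carrier[OF assms(1)] carrier_unionI by blast
    then have "p = p \<otimes>\<^bsub>H\<^esub> \<one>\<^bsub>H\<^esub>" by simp
    then show "p \<in> initial_product H U (Suc k)"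
      unfolding initial_product.simps set_mult_def using p assms(2) by blast
  qed
  then show ?thesis using lift_Suc_mono_le[of "initial_product H U"] assms(3) by blast
qed

lemma nbhd_base_member:
  assumes "symmetric_nbhd_base (G n) (T n) B" "U \<in> B"
  shows "U \<in> open_symmetric_nbhds (G n) (T n)" "U \<subseteq> C n" "\<one>\<^bsub>H\<^esub> \<in> U"
proof -
  show U: "U \<in> open_symmetric_nbhds (G n) (T n)" using assms unfolding symmetric_nbhd_base_def by blast
  show "U \<subseteq> C n" "\<one>\<^bsub>H\<^esub> \<in> U" using stage.open_symmetric_nbhdsD(2,3)[OF U] one_union[of n] by simp_all
qed

text \<open>Applies \<open>limit_nbhd\<close> at an arbitrary point \<open>y\<close> of the
  translate, with the translated partial products as the sets \<open>Q k\<close>. Passing from one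
  to the next inserts a factor of \<open>U (Suc k)\<close> before \<open>x\<close>, as
  \<open>conj_entourage\<close> provides.\<close>

lemma directed_product_open:
  assumes B: "\<And>n. symmetric_nbhd_base (G n) (T n) (B n)" and U: "\<And>n. U n \<in> B n" and x: "x \<in> carrier H"
  shows "openin (uniform_topology (carrier H) limit) (directed_product H U #>\<^bsub>H\<^esub> x)"
proof -
  note UB = nbhd_base_member[OF B U]
  let ?P = "initial_product H U" and ?S = "directed_product H U #>\<^bsub>H\<^esub> x"
  have P: "?P n \<subseteq> C n" for n using UB(2) by (rule initial_product_carrier)
  have PH: "?P n \<subseteq> carrier H" for n using P[of n] carrier_unionI by blast
  have S: "?S = (\<Union>n. ?P n #>\<^bsub>H\<^esub> x)" unfolding directed_product_def r_coset_def by blast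
  have "\<exists>E\<in>limit. E `` {y} \<subseteq> ?S" if y: "y \<in> ?S" for y
  proof -
    obtain m where m: "y \<in> ?P m #>\<^bsub>H\<^esub> x" using y unfolding S by blast
    obtain j where j: "x \<in> C j" using x unfolding carrier_union by blast
    \<comment> \<open>From stage \<open>n\<close> on, \<open>x\<close> can be conjugated with, and
      \<open>y\<close> has already been reached.\<close>
    define n where "n = max m j"
    have xC: "x \<in> C k" if "n \<le> k" for k using j carrier_mono[of j k] that unfolding n_def by auto
    have yP: "y \<in> ?P n #>\<^bsub>H\<^esub> x"
      using m initial_product_mono[of U m n, OF UB(2,3)] unfolding n_def r_coset_def by auto
    have "\<exists>D. D \<in> \<L> k \<and> (n \<le> k \<longrightarrow>
        (\<forall>b z. (b, z) \<in> D \<longrightarrow> (\<exists>u\<in>U k. z = b \<otimes>\<^bsub>H\<^esub> inv\<^bsub>H\<^esub> x \<otimes>\<^bsub>H\<^esub> u \<otimes>\<^bsub>H\<^esub> x)))" for k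
    proof (cases "n \<le> k")
      case True
      then show ?thesis using conj_entourage[OF xC UB(1)] by metis
    next
      \<comment> \<open>Below \<open>n\<close> the stage may miss \<open>x\<close>; the full square
        serves as a default, since \<open>limit_nbhd\<close> asks for closure of \<open>Q\<close>
        only from \<open>n\<close> on.\<close>
      case False
      then show ?thesis using uniformity_onD(1)[OF uniformity] by blast
    qed
    then obtain D where D: "\<And>k. D k \<in> \<L> k" "\<And>k b z. n \<le> k \<Longrightarrow> (b, z) \<in> D k \<Longrightarrow>
        \<exists>u\<in>U k. z = b \<otimes>\<^bsub>H\<^esub> inv\<^bsub>H\<^esub> x \<otimes>\<^bsub>H\<^esub> u \<otimes>\<^bsub>H\<^esub> x"
      by metis
    have yC: "y \<in> C n" using yP P[of n] xC union_closed unfolding r_coset_def by blast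
    have "D (Suc k) `` (?P k #>\<^bsub>H\<^esub> x) \<subseteq> ?P (Suc k) #>\<^bsub>H\<^esub> x" if "n \<le> k" for k
    proof
      fix z assume "z \<in> D (Suc k) `` (?P k #>\<^bsub>H\<^esub> x)"
      then obtain q where q: "q \<in> ?P k" "(q \<otimes>\<^bsub>H\<^esub> x, z) \<in> D (Suc k)" unfolding r_coset_def by blast
      then obtain u where u: "u \<in> U (Suc k)" "z = q \<otimes>\<^bsub>H\<^esub> x \<otimes>\<^bsub>H\<^esub> inv\<^bsub>H\<^esub> x \<otimes>\<^bsub>H\<^esub> u \<otimes>\<^bsub>H\<^esub> x"
        using D(2)[of "Suc k"] \<open>n \<le> k\<close> by auto
      have "q \<in> carrier H" using q PH by blast
      then have "z = q \<otimes>\<^bsub>H\<^esub> u \<otimes>\<^bsub>H\<^esub> x" using x u(2) by (simp add: union.m_assoc)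
      then show "z \<in> ?P (Suc k) #>\<^bsub>H\<^esub> x"
        using q(1) u(1) unfolding r_coset_def initial_product.simps set_mult_def by blast
    qed
    then obtain E where "E \<in> limit" "E `` {y} \<subseteq> (\<Union>k. ?P k #>\<^bsub>H\<^esub> x)"
      by (rule limit_nbhd[of D y n "\<lambda>k. ?P k #>\<^bsub>H\<^esub> x", OF D(1) yC yP])
    then show ?thesis unfolding S by blast
  qed
  moreover have "directed_product H U \<subseteq> carrier H"
    using PH unfolding directed_product_def by blast
  then have "?S \<subseteq> carrier H" using x unfolding r_coset_def by (auto intro: union.m_closed)
  moreover have "uniformity_on (carrier H) limit" using limit_uniformity carrier_union by simp
  ultimately show ?thesis by (simp add: openin_uniform_topology)
qed

text \<open>Multiplying one more factor into the product moves \<open>q y\<close> to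
  \<open>q u y\<close>, a right multiplication by a conjugate of \<open>u\<close>. Each
  \<open>U i\<close> is taken so small that this move lies in the \<open>i\<close>-th entourage of
  \<open>limit_ascending_chains\<close>, whose stage contains \<open>q y\<close> as well as
  \<open>u\<close>.\<close>

lemma directed_product_nbhd:
  assumes B: "\<And>n. symmetric_nbhd_base (G n) (T n) (B n)" and E: "E \<in> limit" and y: "y \<in> carrier H"
  obtains U where "\<And>n. U n \<in> B n" "directed_product H U #>\<^bsub>H\<^esub> y \<subseteq> E `` {y}"
    "y \<in> directed_product H U #>\<^bsub>H\<^esub> y"
proof -
  obtain n where n: "y \<in> C n" using y unfolding carrier_union by blast
  obtain D where D: "\<And>i. D i \<in> \<L> (max n i)"
    "\<And>Q y k. Q 0 \<subseteq> D 0 `` {y} \<Longrightarrow> (\<And>k. Q (Suc k) \<subseteq> D (Suc k) `` Q k) \<Longrightarrow> Q k \<subseteq> E `` {y}"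
    using limit_ascending_chains[OF E, of n] by blast
  have yC: "y \<in> C (max n i)" for i using n carrier_mono[of n "max n i"] by auto
  have "\<exists>U. U \<in> B i \<and> (\<forall>b u. b \<in> C (max n i) \<longrightarrow> u \<in> U \<longrightarrow>
      (b, b \<otimes>\<^bsub>H\<^esub> inv\<^bsub>H\<^esub> y \<otimes>\<^bsub>H\<^esub> u \<otimes>\<^bsub>H\<^esub> y) \<in> D i)" for i
    using conj_nbhd[OF yC D(1) max.cobounded2 B, of i] by metis
  then obtain U where U: "\<And>i. U i \<in> B i" "\<And>i b u. b \<in> C (max n i) \<Longrightarrow> u \<in> U i \<Longrightarrow>
      (b, b \<otimes>\<^bsub>H\<^esub> inv\<^bsub>H\<^esub> y \<otimes>\<^bsub>H\<^esub> u \<otimes>\<^bsub>H\<^esub> y) \<in> D i"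
    by metis
  note UB = nbhd_base_member[OF B U(1)]
  let ?P = "initial_product H U"
  have P: "?P k \<subseteq> C k" for k using UB(2) by (rule initial_product_carrier)
  have "?P k #>\<^bsub>H\<^esub> y \<subseteq> E `` {y}" for k
  proof (rule D(2)[of "\<lambda>k. ?P k #>\<^bsub>H\<^esub> y"])
    show "?P 0 #>\<^bsub>H\<^esub> y \<subseteq> D 0 `` {y}"
    proof
      fix z assume "z \<in> ?P 0 #>\<^bsub>H\<^esub> y"
      then obtain u where u: "u \<in> U 0" "z = u \<otimes>\<^bsub>H\<^esub> y" unfolding r_coset_def by auto
      have "u \<in> carrier H" using u UB(2) carrier_unionI by blast
      then have "y \<otimes>\<^bsub>H\<^esub> inv\<^bsub>H\<^esub> y \<otimes>\<^bsub>H\<^esub> u \<otimes>\<^bsub>H\<^esub> y = z" using u(2) y by simp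
      then show "z \<in> D 0 `` {y}" using U(2)[OF yC u(1)] by auto
    qed
    show "?P (Suc k) #>\<^bsub>H\<^esub> y \<subseteq> D (Suc k) `` (?P k #>\<^bsub>H\<^esub> y)" for k
    proof
      fix z assume "z \<in> ?P (Suc k) #>\<^bsub>H\<^esub> y"
      then obtain q u where q: "q \<in> ?P k" "u \<in> U (Suc k)" "z = q \<otimes>\<^bsub>H\<^esub> u \<otimes>\<^bsub>H\<^esub> y"
        unfolding r_coset_def initial_product.simps set_mult_def by blast
      have "q \<in> C (max n (Suc k))" using q(1) P[of k] carrier_mono[of k "max n (Suc k)"] by (simp add: le_max_iff_disj) blast
      then have "q \<otimes>\<^bsub>H\<^esub> y \<in> C (max n (Suc k))" using yC by (rule union_closed)
      from U(2)[OF this q(2)]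
      have "(q \<otimes>\<^bsub>H\<^esub> y, q \<otimes>\<^bsub>H\<^esub> y \<otimes>\<^bsub>H\<^esub> inv\<^bsub>H\<^esub> y \<otimes>\<^bsub>H\<^esub> u \<otimes>\<^bsub>H\<^esub> y) \<in> D (Suc k)" .
      moreover have "q \<in> carrier H" "u \<in> carrier H"
        using q P UB(2) carrier_unionI by blast+
      then have "q \<otimes>\<^bsub>H\<^esub> y \<otimes>\<^bsub>H\<^esub> inv\<^bsub>H\<^esub> y = q" using y by (simp add: union.m_assoc)
      ultimately have "(q \<otimes>\<^bsub>H\<^esub> y, z) \<in> D (Suc k)" using q(3) by simp
      then show "z \<in> D (Suc k) `` (?P k #>\<^bsub>H\<^esub> y)" using q(1) unfolding r_coset_def by blast
    qed
  qed
  then have "directed_product H U #>\<^bsub>H\<^esub> y \<subseteq> E `` {y}"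
    unfolding directed_product_def r_coset_def by blast
  moreover have "\<one>\<^bsub>H\<^esub> \<in> directed_product H U"
    unfolding directed_product_def using UB(3)[of 0] by (intro UN_I[of 0]) auto
  then have "\<one>\<^bsub>H\<^esub> \<otimes>\<^bsub>H\<^esub> y \<in> directed_product H U #>\<^bsub>H\<^esub> y" unfolding r_coset_def by blast
  then have "y \<in> directed_product H U #>\<^bsub>H\<^esub> y" using y by simp
  ultimately show thesis using U(1) that by blast
qed

lemma uniform_topology_eq_tau_right:
  assumes B: "\<And>n. symmetric_nbhd_base (G n) (T n) (B n)"
  shows "uniform_topology (carrier H) limit = tau_right G B"
  unfolding topology_eq
proof (intro allI iffI)
  fix S assume S: "openin (uniform_topology (carrier H) limit) S"
  have unif: "uniformity_on (carrier H) limit" using limit_uniformity carrier_union by simp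
  have "\<exists>V. openin (tau_right G B) V \<and> y \<in> V \<and> V \<subseteq> S" if y: "y \<in> S" for y
  proof -
    obtain E where E: "E \<in> limit" "E `` {y} \<subseteq> S" and yH: "y \<in> carrier H"
      using S y unfolding openin_uniform_topology[OF unif] by blast
    obtain U where U: "\<And>n. U n \<in> B n" "directed_product H U #>\<^bsub>H\<^esub> y \<subseteq> E `` {y}"
      "y \<in> directed_product H U #>\<^bsub>H\<^esub> y"
      using directed_product_nbhd[OF B E(1) yH] by blast
    have "openin (tau_right G B) (directed_product H U #>\<^bsub>H\<^esub> y)"
      unfolding tau_right_def by (rule topology_generated_by_Basis) (use U(1) yH in blast)
    then show ?thesis using U E(2) by blast
  qed
  then show "openin (tau_right G B) S" using openin_subopen by blast
next
  fix S assume "openin (tau_right G B) S"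
  then have "generate_topology_on {directed_product H U #>\<^bsub>H\<^esub> x | U x.
      (\<forall>n. U n \<in> B n) \<and> x \<in> carrier H} S"
    unfolding tau_right_def openin_topology_generated_by_iff .
  then show "openin (uniform_topology (carrier H) limit) S"
    by (rule generate_topology_on_coarsest[OF istopology_openin, rotated])
      (use directed_product_open[OF B] in blast)
qed

end

theorem theorem9p1:
  fixes G :: "nat \<Rightarrow> 'a monoid"
    and T :: "nat \<Rightarrow> 'a topology"
  assumes "tower_of_topological_groups G T"
  shows "(\<forall>\<B>. (\<forall>n. symmetric_nbhd_base (G n) (T n) (\<B> n)) \<longrightarrow>
            uniform_topology (carrier (union_group G))
              (uniform_direct_limit (\<lambda>n. carrier (G n)) (\<lambda>n. left_uniformity (G n) (T n)))
            = tau_right G \<B>) \<and>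
         (\<forall>\<A>. adequate_family (\<lambda>n. carrier (G n)) (\<lambda>n. left_uniformity (G n) (T n)) \<A> \<longrightarrow>
            uniformity_generated_by_pseudometrics (carrier (union_group G))
              (uniform_direct_limit (\<lambda>n. carrier (G n)) (\<lambda>n. left_uniformity (G n) (T n)))
              (lim_pseudometric (\<lambda>n. carrier (G n)) ` \<A>))"
proof -
  interpret group_tower G T using assms by unfold_locales
  show ?thesis
    using uniform_topology_eq_tau_right limit_generated_by_pseudometrics carrier_union by simp
qed

end
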